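(* Let $\Omega=\mathbb{R}^d/\mathbb{Z}^d$, let $\pi$ be a probability measure on $\Omega$, let $m\ge1$ be an integer and let $\alpha_1,\dots,\alpha_m$ be positive reals. Let $h:\Omega\to\mathbb{R}$ be a Lipschitz continuous kernel with $\hat h(\xi)\neq0$ for all $\xi\in\mathbb{Z}^d$. For every real $T>0$, let $\mu_T^*\in\mathcal{M}(\mathcal{P}_T^{m,\infty})$ denote any solution of $$\inf_{\mu\in\mathcal{M}(\mathcal{P}_T^{m,\infty})}\mathcal{N}_h(\mu-\pi).$$ Then: (i) $\mu_T^*$ converges weakly to $\pi$ as $T\to\infty$; (ii) $\mathcal{N}_h(\mu_T^*-\pi)=\mathcal{O}\left(T^{-\frac{m}{m(d+1)-1}}\right)$ as $T\to\infty$.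
   Context: $\mathcal{N}_h(\mu)=\|h\star\mu\|_{L^2(\Omega)}$ with $h\star\mu(x)=\int_\Omega h(x-y)\,d\mu(y)$; $\hat h(\xi)=\int_\Omega e^{-2i\pi\langle\xi,x\rangle}h(x)\,dx$. $\mathcal{P}_T^{m,\infty}$ is the set of curves $p:[0,T]\to\Omega$ of Sobolev class $W^{m,\infty}$ (i.e. possessing a continuous lift to $\mathbb{R}^d$ in $(W^{m,\infty}([0,T]))^d$) such that $\|p^{(i)}\|_\infty\leq\alpha_i$ for all $i\in\{1,\dots,m\}$, where $p^{(i)}$ is the $i$-th derivative (of the lift) and $\|\cdot\|_\infty$ is the essential supremum over $[0,T]$ of the Euclidean norm. $\gamma_T$ is the normalized Lebesgue measure on $[0,T]$ (total mass 1), $p_*\gamma_T(B)=\gamma_T(p^{-1}(B))$ is the pushforward, and $\mathcal{M}(\mathcal{P}_T^{m,\infty})=\{p_*\gamma_T:\ p\in\mathcal{P}_T^{m,\infty}\}$. Weak convergence means convergence of integrals of all continuous functions on $\Omega$. The numbers $\alpha_i$ do not depend on $T$. *)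

theory Defs
  imports "HOL-Probability.Probability"
begin

text \<open>The torus $\mathbb{R}^d/\mathbb{Z}^d$; the dimension $d$ is the cardinality of the finite index type \<^typ>\<open>'n\<close>.\<close>

definition torus_eq :: "real ^ 'n \<Rightarrow> real ^ 'n \<Rightarrow> bool" where
  "torus_eq x y \<longleftrightarrow> (\<forall>i. x $ i - y $ i \<in> \<int>)"

lemma torus_eq_equivp: "equivp (torus_eq :: real ^ 'n \<Rightarrow> real ^ 'n \<Rightarrow> bool)"
proof (rule equivpI)
  show "reflp (torus_eq :: real ^ 'n \<Rightarrow> _)" by (simp add: reflp_def torus_eq_def)
  show "symp (torus_eq :: real ^ 'n \<Rightarrow> _)"
    unfolding symp_def torus_eq_def
  proof (intro allI impI)
    fix x y :: "real ^ 'n" and i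
    assume "\<forall>i. x $ i - y $ i \<in> \<int>"
    then have "- (x $ i - y $ i) \<in> \<int>" by - (rule Ints_minus; blast)
    then show "y $ i - x $ i \<in> \<int>" by simp
  qed
  show "transp (torus_eq :: real ^ 'n \<Rightarrow> _)"
    unfolding transp_def torus_eq_def
  proof (intro allI impI)
    fix x y z :: "real ^ 'n" and i
    assume "\<forall>i. x $ i - y $ i \<in> \<int>" "\<forall>i. y $ i - z $ i \<in> \<int>"
    then have "(x $ i - y $ i) + (y $ i - z $ i) \<in> \<int>" by - (rule Ints_add; blast)
    then show "x $ i - z $ i \<in> \<int>" by simp
  qed
qed

quotient_type 'n torus = "real ^ ('n::finite)" / torus_eq
  morphisms rep_torus torus_proj
  by (rule torus_eq_equivp)

lemma torus_proj_eq_iff: "torus_proj a = torus_proj b \<longleftrightarrow> torus_eq a b"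
  by (fact torus.abs_eq_iff)

lemma torus_proj_surj: "\<exists>a. torus_proj a = x"
  using Quotient_abs_rep[OF Quotient_torus] by blast

instantiation torus :: (finite) ab_group_add
begin

lift_definition zero_torus :: "'a torus" is "0" .
lift_definition plus_torus :: "'a torus \<Rightarrow> 'a torus \<Rightarrow> 'a torus" is "(+)"
  unfolding torus_eq_def
proof -
  fix a b c d :: "real ^ 'a"
  assume "\<forall>i. a $ i - b $ i \<in> \<int>" "\<forall>i. c $ i - d $ i \<in> \<int>"
  then have "(a $ i - b $ i) + (c $ i - d $ i) \<in> \<int>" for i by - (rule Ints_add; blast)
  then show "\<forall>i. (a + c) $ i - (b + d) $ i \<in> \<int>" by (simp add: algebra_simps)
qed
lift_definition uminus_torus :: "'a torus \<Rightarrow> 'a torus" is "uminus"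
  unfolding torus_eq_def
proof -
  fix a b :: "real ^ 'a"
  assume "\<forall>i. a $ i - b $ i \<in> \<int>"
  then have "- (a $ i - b $ i) \<in> \<int>" for i by - (rule Ints_minus; blast)
  then show "\<forall>i. (- a) $ i - (- b) $ i \<in> \<int>" by simp
qed
lift_definition minus_torus :: "'a torus \<Rightarrow> 'a torus \<Rightarrow> 'a torus" is "(-)"
  unfolding torus_eq_def
proof -
  fix a b c d :: "real ^ 'a"
  assume "\<forall>i. a $ i - b $ i \<in> \<int>" "\<forall>i. c $ i - d $ i \<in> \<int>"
  then have "(a $ i - b $ i) - (c $ i - d $ i) \<in> \<int>" for i by - (rule Ints_diff; blast)
  then show "\<forall>i. (a - c) $ i - (b - d) $ i \<in> \<int>" by (simp add: algebra_simps)
qed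

instance
  by standard (transfer; simp add: torus_eq_def algebra_simps)+

end

lemma torus_proj_shift: "torus_proj b = torus_proj c \<Longrightarrow> torus_proj (a + (b - c)) = torus_proj a"
  by (simp add: torus_proj_eq_iff torus_eq_def)

definition torus_dists :: "('n::finite) torus \<Rightarrow> 'n torus \<Rightarrow> real set" where
  "torus_dists x y = {dist a b | a b. torus_proj a = x \<and> torus_proj b = y}"

lemma torus_dists_nonempty: "torus_dists x y \<noteq> {}"
proof -
  obtain a b where "torus_proj a = x" "torus_proj b = y"
    using torus_proj_surj[of x] torus_proj_surj[of y] by auto
  then have "dist a b \<in> torus_dists x y" unfolding torus_dists_def by blast
  then show ?thesis by blast
qed

lemma torus_dists_bdd_below: "bdd_below (torus_dists x y)"
  unfolding torus_dists_def by (intro bdd_belowI[of _ 0]) auto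

lemma torus_dists_lessD:
  assumes "Inf (torus_dists x y) < e" and a: "torus_proj a = x"
  shows "\<exists>b. torus_proj b = y \<and> dist a b < e"
proof -
  obtain a' b' where ab: "torus_proj a' = x" "torus_proj b' = y" "dist a' b' < e"
    using cInf_lessD[OF torus_dists_nonempty assms(1)] unfolding torus_dists_def by auto
  show ?thesis
  proof (intro exI conjI)
    show "torus_proj (b' + (a - a')) = y"
      using torus_proj_shift[of a a' b'] a ab by simp
    show "dist a (b' + (a - a')) < e"
      using ab(3) by (simp add: dist_norm algebra_simps)
  qed
qed

text \<open>The quotient metric: the Euclidean distance between the closest representatives.\<close>

instantiation torus :: (finite) metric_space
begin

definition dist_torus :: "'a torus \<Rightarrow> 'a torus \<Rightarrow> real" where
  "dist_torus x y = Inf {dist a b | a b. torus_proj a = x \<and> torus_proj b = y}"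

definition uniformity_torus :: "('a torus \<times> 'a torus) filter" where
  "uniformity_torus = (INF e\<in>{0<..}. principal {(x, y). dist x y < e})"

definition open_torus :: "'a torus set \<Rightarrow> bool" where
  "open_torus U \<longleftrightarrow> (\<forall>x\<in>U. eventually (\<lambda>(x', y). x' = x \<longrightarrow> y \<in> U) uniformity)"

instance
proof
  have D: "dist x y = Inf (torus_dists x y)" for x y :: "'a torus"
    unfolding dist_torus_def torus_dists_def ..
  have nonneg: "dist x y \<ge> 0" for x y :: "'a torus"
    unfolding D by (intro cInf_greatest torus_dists_nonempty) (auto simp: torus_dists_def)
  have le: "dist (torus_proj a) (torus_proj b) \<le> dist a b" for a b :: "real ^ 'a"
    unfolding D by (intro cInf_lower torus_dists_bdd_below) (auto simp: torus_dists_def)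
  have sym: "dist x y = dist y x" for x y :: "'a torus"
    unfolding dist_torus_def by (rule arg_cong[of _ _ Inf]) (use dist_commute in blast)
  show "dist x y = 0 \<longleftrightarrow> x = y" for x y :: "'a torus"
  proof
    assume eq: "dist x y = 0"
    show "x = y"
    proof (rule ccontr)
      assume "x \<noteq> y"
      obtain a b where ab: "torus_proj a = x" "torus_proj b = y"
        using torus_proj_surj by metis
      then obtain i where i: "a $ i - b $ i \<notin> \<int>"
        using \<open>x \<noteq> y\<close> torus_proj_eq_iff[of a b] by (auto simp: torus_eq_def)
      define r where "r = a $ i - b $ i"
      define \<delta> where "\<delta> = min (frac r) (1 - frac r)"
      have "\<delta> > 0" using i frac_lt_1[of r] frac_ge_0[of r] frac_eq_0_iff[of r]
        by (auto simp: \<delta>_def r_def)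
      then obtain b' where b': "torus_proj b' = y" "dist a b' < \<delta>"
        using torus_dists_lessD[of x y \<delta> a] eq ab unfolding D by auto
      have "b' $ i - b $ i \<in> \<int>"
        using b' ab torus_proj_eq_iff[of b' b] by (simp add: torus_eq_def)
      then obtain k :: int where k: "b' $ i - b $ i = of_int k" by (auto elim: Ints_cases)
      have "\<bar>a $ i - b' $ i\<bar> < \<delta>"
        using b'(2) component_le_norm_cart[of "a - b'" i] by (simp add: dist_norm)
      moreover have "a $ i - b' $ i = frac r + of_int (\<lfloor>r\<rfloor> - k)"
        using k by (simp add: frac_def r_def)
      moreover have "\<bar>frac r + of_int n\<bar> \<ge> \<delta>" for n :: int
      proof (cases "n \<ge> 0")
        case True
        then show ?thesis using frac_ge_0[of r] by (simp add: \<delta>_def)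
      next
        case False
        then have "of_int n \<le> (-1 :: real)" by linarith
        then show ?thesis by (simp add: \<delta>_def)
      qed
      ultimately show False by (metis not_less)
    qed
  next
    assume "x = y"
    obtain a where a: "torus_proj a = x" using torus_proj_surj by metis
    from \<open>x = y\<close> show "dist x y = 0"
      using le[of a a] nonneg[of x x] a by simp
  qed
  show "dist x y \<le> dist x z + dist y z" for x y z :: "'a torus"
  proof (rule field_le_epsilon)
    fix e :: real assume "e > 0"
    obtain c where c: "torus_proj c = z" using torus_proj_surj by metis
    obtain a where a: "torus_proj a = x" "dist c a < dist z x + e / 2"
      using torus_dists_lessD[of z x "dist z x + e / 2" c] c \<open>e > 0\<close> unfolding D by auto
    obtain b where b: "torus_proj b = y" "dist c b < dist z y + e / 2"
      using torus_dists_lessD[of z y "dist z y + e / 2" c] c \<open>e > 0\<close> unfolding D by auto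
    have "dist x y \<le> dist a b" using le[of a b] a b by simp
    also have "\<dots> \<le> dist c a + dist c b" using dist_triangle2[of a b c] by (simp add: dist_commute)
    also have "\<dots> \<le> dist x z + dist y z + e"
      using a b sym[of x z] sym[of y z] by simp
    finally show "dist x y \<le> dist x z + dist y z + e" .
  qed
qed (fact uniformity_torus_def open_torus_def)+

end

lemma dist_torus_proj_le: "dist (torus_proj a) (torus_proj b) \<le> dist a b"
proof -
  have "dist a b \<in> torus_dists (torus_proj a) (torus_proj b)"
    unfolding torus_dists_def by blast
  then show ?thesis
    unfolding dist_torus_def torus_dists_def[symmetric] by (rule cInf_lower[OF _ torus_dists_bdd_below])
qed

text \<open>The metric topology is the quotient topology.\<close>

lemma open_torus_iff: "open U \<longleftrightarrow> open (torus_proj -` U)"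
proof
  assume "open U"
  show "open (torus_proj -` U)"
    unfolding open_dist
  proof safe
    fix a assume "torus_proj a \<in> U"
    then obtain e where "e > 0" "\<And>y. dist y (torus_proj a) < e \<Longrightarrow> y \<in> U"
      using \<open>open U\<close> unfolding open_dist by blast
    then show "\<exists>e>0. \<forall>b. dist b a < e \<longrightarrow> b \<in> torus_proj -` U"
      using le_less_trans[OF dist_torus_proj_le] by blast
  qed
next
  assume o: "open (torus_proj -` U)"
  show "open U"
    unfolding open_dist
  proof
    fix x assume "x \<in> U"
    obtain a where a: "torus_proj a = x" using torus_proj_surj by metis
    then obtain e where e: "e > 0" "\<And>b. dist b a < e \<Longrightarrow> torus_proj b \<in> U"
      using o \<open>x \<in> U\<close> unfolding open_dist by blast
    have "y \<in> U" if "dist y x < e" for y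
    proof -
      have "Inf (torus_dists x y) < e"
        using that by (simp add: dist_commute dist_torus_def torus_dists_def)
      then obtain b where "torus_proj b = y" "dist a b < e"
        using torus_dists_lessD[of x y e a] a by auto
      then show ?thesis using e(2)[of b] by (simp add: dist_commute)
    qed
    then show "\<exists>e>0. \<forall>y. dist y x < e \<longrightarrow> y \<in> U" using e by blast
  qed
qed

text \<open>The image of Lebesgue measure on the half-open unit cube, a fundamental domain.\<close>

definition torus_lebesgue :: "('n::finite) torus measure" where
  "torus_lebesgue = distr (restrict_space lborel {x. \<forall>i. 0 \<le> x $ i \<and> x $ i < 1}) borel torus_proj"

text \<open>The character $x \mapsto e^{-2 i \pi \langle \xi, x\rangle}$, which is well defined modulo
  $\mathbb{Z}^d$ because the frequency $\xi$ is integral.\<close>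

lift_definition torus_char :: "int ^ 'n \<Rightarrow> ('n::finite) torus \<Rightarrow> complex" is
  "\<lambda>\<xi> x. exp (- 2 * \<i> * of_real pi * of_real (\<Sum>i\<in>UNIV. of_int (\<xi> $ i) * x $ i))"
proof -
  fix \<xi> :: "int ^ 'n" and x y :: "real ^ 'n"
  assume "torus_eq x y"
  then have "(\<Sum>i\<in>UNIV. of_int (\<xi> $ i) * (x $ i - y $ i)) \<in> \<int>"
    by (intro Ints_sum Ints_mult) (auto simp: torus_eq_def)
  then obtain k :: int where "(\<Sum>i\<in>UNIV. of_int (\<xi> $ i) * (x $ i - y $ i)) = of_int k"
    by (auto elim: Ints_cases)
  then have k: "(\<Sum>i\<in>UNIV. of_int (\<xi> $ i) * x $ i)
      = (\<Sum>i\<in>UNIV. of_int (\<xi> $ i) * y $ i) + (of_int k :: real)"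
    by (simp add: right_diff_distrib sum_subtractf)
  show "exp (- 2 * \<i> * of_real pi * of_real (\<Sum>i\<in>UNIV. of_int (\<xi> $ i) * x $ i))
      = exp (- 2 * \<i> * of_real pi * of_real (\<Sum>i\<in>UNIV. of_int (\<xi> $ i) * y $ i))"
    unfolding k exp_eq by (intro exI[of _ "- k"]) (simp add: algebra_simps)
qed

definition torus_fourier :: "(('n::finite) torus \<Rightarrow> real) \<Rightarrow> int ^ 'n \<Rightarrow> complex" where
  "torus_fourier h \<xi> = (\<integral>x. torus_char \<xi> x * of_real (h x) \<partial>torus_lebesgue)"

definition conv_measure :: "(('n::finite) torus \<Rightarrow> real) \<Rightarrow> 'n torus measure \<Rightarrow> 'n torus \<Rightarrow> real" where
  "conv_measure h \<mu> x = (\<integral>y. h (x - y) \<partial>\<mu>)"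

text \<open>Signed measures occur only as differences of two probability measures, and integration
  against such a difference is the difference of the integrals, so that
  $h \star (\mu - \nu) = h \star \mu - h \star \nu$.\<close>

definition N_diff :: "(('n::finite) torus \<Rightarrow> real) \<Rightarrow> 'n torus measure \<Rightarrow> 'n torus measure \<Rightarrow> real" where
  "N_diff h \<mu> \<nu> = sqrt (\<integral>x. (conv_measure h \<mu> x - conv_measure h \<nu> x)\<^sup>2 \<partial>torus_lebesgue)"

definition test_functions :: "real \<Rightarrow> (real \<Rightarrow> real) set" where
  "test_functions T = {\<phi>. (\<forall>k x. (deriv ^^ k) \<phi> differentiable at x) \<and>
     (\<exists>K. compact K \<and> K \<subseteq> {0<..<T} \<and> (\<forall>x. x \<notin> K \<longrightarrow> \<phi> x = 0))}"

definition Linf_norm :: "real \<Rightarrow> (real \<Rightarrow> 'a::euclidean_space) \<Rightarrow> ereal" where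
  "Linf_norm T g = esssup (lebesgue_on {0..T}) (\<lambda>t. ereal (norm (g t)))"

definition Linf :: "real \<Rightarrow> (real \<Rightarrow> 'a::euclidean_space) set" where
  "Linf T = {g \<in> borel_measurable (lebesgue_on {0..T}). Linf_norm T g < \<infinity>}"

definition weak_deriv :: "real \<Rightarrow> nat \<Rightarrow> (real \<Rightarrow> 'a::euclidean_space) \<Rightarrow> (real \<Rightarrow> 'a) \<Rightarrow> bool" where
  "weak_deriv T i f g \<longleftrightarrow> (\<forall>\<phi>\<in>test_functions T.
     (\<integral>t. (deriv ^^ i) \<phi> t *\<^sub>R f t \<partial>lebesgue_on {0..T})
       = (- 1) ^ i *\<^sub>R (\<integral>t. \<phi> t *\<^sub>R g t \<partial>lebesgue_on {0..T}))"

definition Sobolev_inf :: "nat \<Rightarrow> real \<Rightarrow> (real \<Rightarrow> 'a::euclidean_space) set" where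
  "Sobolev_inf m T = {f \<in> Linf T. \<forall>i\<in>{1..m}. \<exists>g\<in>Linf T. weak_deriv T i f g}"

text \<open>A curve is represented by a total function of which only the restriction to the interval
  from 0 to \<open>T\<close> matters; \<open>q\<close> is its continuous lift. Weak derivatives are unique up to null
  sets, so the choice of \<open>g\<close> is irrelevant.\<close>

definition curves :: "nat \<Rightarrow> (nat \<Rightarrow> real) \<Rightarrow> real \<Rightarrow> (real \<Rightarrow> ('n::finite) torus) set" where
  "curves m \<alpha> T = {p. \<exists>q. continuous_on {0..T} q \<and> q \<in> Sobolev_inf m T \<and>
     (\<forall>t\<in>{0..T}. p t = torus_proj (q t)) \<and>
     (\<forall>i\<in>{1..m}. \<exists>g\<in>Linf T. weak_deriv T i q g \<and> Linf_norm T g \<le> ereal (\<alpha> i))}"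

definition gamma :: "real \<Rightarrow> real measure" where
  "gamma T = uniform_measure (lebesgue_on {0..T}) {0..T}"

definition curve_measures :: "nat \<Rightarrow> (nat \<Rightarrow> real) \<Rightarrow> real \<Rightarrow> ('n::finite) torus measure set" where
  "curve_measures m \<alpha> T = (\<lambda>p. distr (gamma T) borel p) ` curves m \<alpha> T"

definition weakly_converges ::
    "('i \<Rightarrow> ('a::topological_space) measure) \<Rightarrow> 'a measure \<Rightarrow> 'i filter \<Rightarrow> bool" where
  "weakly_converges \<mu> \<nu> F \<longleftrightarrow>
     (\<forall>f :: 'a \<Rightarrow> real. continuous_on UNIV f \<longrightarrow>
       ((\<lambda>T. \<integral>x. f x \<partial>\<mu> T) \<longlongrightarrow> (\<integral>x. f x \<partial>\<nu>)) F)"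

end

theory Submission
  imports Defs
begin

text \<open>For (ii), a competitor is built from the $n^d$ points of $(\frac1n\mathbb{Z})^d/\mathbb{Z}^d$. The
  curve visits them in an order in which consecutive points are $O(1/n)$ apart, rests at each for
  a time proportional to the mass that \<open>\<pi>\<close> puts near it, and moves between neighbours along a
  smooth step whose duration $O(n^{-1/m})$ is the least that the bounds \<open>\<alpha>\<^sub>i\<close> permit. Hence
  $h\star(\mu-\pi)$ is uniformly $O(1/n)+O(n^{d-1/m}/T)$, and \<open>n\<close> of the order of
  $T^{m/(m(d+1)-1)}$ balances the two terms. For (i), by Fubini and Cauchy-Schwarz
  $|\hat h(\xi)|\,|\hat\mu(\xi)-\hat\pi(\xi)|\le\mathcal{N}_h(\mu-\pi)$, so every Fourier coefficient
  of \<open>\<mu> T\<close> converges to that of \<open>\<pi>\<close>, and trigonometric polynomials are uniformly dense in the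
  continuous functions.\<close>

section \<open>Smooth steps and weak derivatives\<close>

text \<open>The exponent comes from scaling. A move over a distance r in time \<tau> has an i-th
  derivative of order r / \<tau>^i. With r of order 1/n and \<tau> at most of order 1, the bound on
  the m-th derivative is the restrictive one and forces \<tau> to be of order n^(-1/m). The n^d
  moves then consume n^(d-1/m) of the total time T, which displaces that fraction of the mass; the
  balance 1/n = n^(d-1/m)/T reads n^(d+1-1/m) = T. Two obstacles shape the construction. The curve
  must stay smooth where rests and moves meet, so a step must begin and end with vanishing
  derivatives up to order m; and the time windows of the moves must be disjoint, so that a sum of
  n^d scaled steps has derivatives no larger than those of a single one. Errors are estimated
  uniformly in x, so the weights and the curve must serve all translates h(x - y) at once; they are
  therefore built for all Lipschitz functions together. Part (i) rests on (ii): the rate shows that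
  the minimal value tends to 0.\<close>

definition deriv_chain :: "nat \<Rightarrow> (nat \<Rightarrow> real \<Rightarrow> 'a::real_normed_vector) \<Rightarrow> bool" where
  "deriv_chain m D \<longleftrightarrow>
     (\<forall>i<m. \<forall>t. (D i has_vector_derivative D (Suc i) t) (at t)) \<and> continuous_on UNIV (D m)"

lemma deriv_chain_continuous_on:
  assumes "deriv_chain m D" "i \<le> m"
  shows "continuous_on S (D i)"
proof -
  have "continuous_on UNIV (D i)"
  proof (cases "i = m")
    case False
    then have "\<forall>t. (D i has_vector_derivative D (Suc i) t) (at t)"
      using assms by (simp add: deriv_chain_def)
    then show ?thesis
      by (blast intro: continuous_at_imp_continuous_on has_vector_derivative_continuous)
  qed (use assms in \<open>simp add: deriv_chain_def\<close>)
  then show ?thesis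
    by (rule continuous_on_subset) simp
qed

text \<open>All derivatives up to order \<open>m\<close> vanish outside (0, 1), so a step can be
  glued to constant pieces without loss of smoothness. Carrying the derivatives as an explicit
  family \<open>D\<close> gives those of rescaled sums by a formula.\<close>

definition step_chain :: "nat \<Rightarrow> (nat \<Rightarrow> real \<Rightarrow> real) \<Rightarrow> bool" where
  "step_chain m D \<longleftrightarrow> deriv_chain m D \<and> (\<forall>t\<le>0. D 0 t = 0) \<and> (\<forall>t\<ge>1. D 0 t = 1) \<and>
     (\<forall>i\<in>{1..m}. \<forall>t. t \<notin> {0<..<1} \<longrightarrow> D i t = 0)"

text \<open>An antiderivative \<open>F\<close> is constant where \<open>f\<close> is 0, and
  \<open>F t - t\<close> is constant where \<open>f\<close> is 1; normalizing \<open>F\<close> at 0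
  leaves only the offset \<open>c\<close>.\<close>

lemma ex_step_antiderivative:
  fixes f :: "real \<Rightarrow> real"
  assumes f: "continuous_on UNIV f" "\<And>t. t \<le> 0 \<Longrightarrow> f t = 0" "\<And>t. t \<ge> 1 \<Longrightarrow> f t = 1"
  obtains G c where "\<And>t. (G has_real_derivative f t) (at t)" "\<And>t. t \<le> 0 \<Longrightarrow> G t = 0"
    "\<And>t. t \<ge> 1 \<Longrightarrow> G t = t + c"
proof -
  obtain F where "\<forall>x::real. -\<infinity> < ereal x \<longrightarrow> ereal x < \<infinity> \<longrightarrow> (F has_vector_derivative f x) (at x)"
    using einterval_antiderivative[of "-\<infinity>" \<infinity> f] f(1) by (auto simp: continuous_on_eq_continuous_at)
  then have F: "(F has_real_derivative f x) (at x)" for x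
    by (simp add: has_real_derivative_iff_has_vector_derivative)
  have cF: "continuous_on S F" for S
    by (rule DERIV_continuous_on) (rule has_field_derivative_at_within[OF F])
  have F0: "F t = F 0" if "t \<le> 0" for t
  proof (cases "t = 0")
    case False
    have "(F has_real_derivative 0) (at x)" if "x < 0" for x
      using F[of x] f(2)[of x] that by simp
    then show ?thesis
      using DERIV_isconst_end[of t 0 F] cF that False by simp
  qed simp
  have F1: "F t - t = F 1 - 1" if "t \<ge> 1" for t
  proof (cases "t = 1")
    case False
    then show ?thesis
    proof (intro DERIV_isconst_end[of 1 t "\<lambda>t. F t - t"])
      fix x assume "1 < x" "x < t"
      then show "((\<lambda>t. F t - t) has_real_derivative 0) (at x)"
        using F[of x] f(3)[of x] by (auto intro!: derivative_eq_intros)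
    qed (use that in \<open>auto intro!: continuous_intros cF\<close>)
  qed simp
  show thesis
  proof (rule that[of "\<lambda>t. F t - F 0" "F 1 - 1 - F 0"])
    show "((\<lambda>t. F t - F 0) has_real_derivative f t) (at t)" for t
      using F[of t] by (auto intro!: derivative_eq_intros)
  next
    show "F t - F 0 = 0" if "t \<le> 0" for t using F0[OF that] by simp
    show "F t - F 0 = t + (F 1 - 1 - F 0)" if "t \<ge> 1" for t using F1[OF that] by simp
  qed
qed

text \<open>Integration raises the order of smoothness by one, so induction from the merely
  continuous ramp \<open>max 0 (min 1 t)\<close> reaches every \<open>m\<close>.\<close>

lemma ex_step_chain: "\<exists>D. step_chain m D"
proof (induction m)
  case 0
  have "step_chain 0 (\<lambda>_ t. max 0 (min 1 t))"
    by (auto simp: step_chain_def deriv_chain_def intro!: continuous_intros)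
  then show ?case by blast
next
  case (Suc m)
  then obtain D where D: "step_chain m D" ..
  then have D0: "continuous_on UNIV (D 0)" "\<And>t. t \<le> 0 \<Longrightarrow> D 0 t = 0" "\<And>t. t \<ge> 1 \<Longrightarrow> D 0 t = 1"
    using deriv_chain_continuous_on[of m D 0] by (auto simp: step_chain_def)
  obtain G c where G: "\<And>t. (G has_real_derivative D 0 t) (at t)" "\<And>t. t \<le> 0 \<Longrightarrow> G t = 0"
    "\<And>t. t \<ge> 1 \<Longrightarrow> G t = t + c"
    using ex_step_antiderivative[OF D0] by metis
  \<comment> \<open>\<open>G (2 * t) - G (2 * t - 1)\<close> is a step with one more derivative: since \<open>G t = t + c\<close> for
    \<open>t \<ge> 1\<close>, it equals 1 there without any normalization.\<close>
  define E where "E i t = (case i of 0 \<Rightarrow> G (2 * t) - G (2 * t - 1)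
    | Suc j \<Rightarrow> 2 ^ i * (D j (2 * t) - D j (2 * t - 1)))" for i t
  have "step_chain (Suc m) E"
    unfolding step_chain_def deriv_chain_def
  proof (intro conjI allI impI ballI)
    fix i t assume "i < Suc m"
    show "(E i has_vector_derivative E (Suc i) t) (at t)"
    proof (cases i)
      case 0
      have "((\<lambda>t. G (2 * t) - G (2 * t - 1)) has_real_derivative (D 0 (2 * t) * 2 - D 0 (2 * t - 1) * 2)) (at t)"
        by (intro DERIV_diff DERIV_chain2[OF G(1)]) (auto intro!: derivative_eq_intros)
      then show ?thesis
        by (simp add: 0 E_def[abs_def] has_real_derivative_iff_has_vector_derivative algebra_simps)
    next
      case (Suc j)
      then have d: "(D j has_real_derivative D i t) (at t)" for t
        using D \<open>i < Suc m\<close> by (simp add: step_chain_def deriv_chain_def has_real_derivative_iff_has_vector_derivative)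
      have "((\<lambda>t. 2 ^ i * (D j (2 * t) - D j (2 * t - 1))) has_real_derivative 2 ^ i * (D i (2 * t) * 2 - D i (2 * t - 1) * 2)) (at t)"
        by (intro DERIV_cmult DERIV_diff DERIV_chain2[OF d]) (auto intro!: derivative_eq_intros)
      then show ?thesis
        by (simp add: Suc E_def[abs_def] has_real_derivative_iff_has_vector_derivative algebra_simps)
    qed
  next
    have "continuous_on UNIV (D m)"
      using D by (auto simp: step_chain_def intro: deriv_chain_continuous_on)
    then have "continuous_on UNIV (\<lambda>t. D m (2 * t))" "continuous_on UNIV (\<lambda>t. D m (2 * t - 1))"
      by (rule continuous_on_compose2; auto intro!: continuous_intros)+
    then show "continuous_on UNIV (E (Suc m))"
      by (simp add: E_def[abs_def] continuous_on_mult_left continuous_on_diff)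
  next
    fix i t assume i: "i \<in> {1..Suc m}" and t: "t \<notin> {0<..<1::real}"
    then obtain j where j: "i = Suc j" "j \<le> m" by (cases i) auto
    \<comment> \<open>For \<open>t \<le> 0\<close> both arguments are at most 0 and for
      \<open>t \<ge> 1\<close> both are at least 1, so they lie in the same region of
      constancy.\<close>
    have "D j (2 * t) = D j (2 * t - 1)"
    proof (cases "j = 0")
      case True
      then show ?thesis using D0(2,3)[of "2 * t"] D0(2,3)[of "2 * t - 1"] t by (cases "t \<le> 0") auto
    next
      case False
      then show ?thesis using D t j by (auto simp: step_chain_def)
    qed
    then show "E i t = 0" by (simp add: E_def j)
  qed (auto simp: E_def G)
  then show ?case by blast
qed

text \<open>Each of the finitely many functions is continuous on the compact interval [0, 1] and
  takes only the values 0 and 1 outside it.\<close>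

lemma step_chain_bounded:
  assumes "step_chain m D"
  obtains K where "K \<ge> 1" "\<And>i t. i \<le> m \<Longrightarrow> \<bar>D i t\<bar> \<le> K"
proof -
  have "\<exists>B. \<forall>t. \<bar>D i t\<bar> \<le> B" if "i \<le> m" for i
  proof -
    have "compact (D i ` {0..1})"
      using assms that deriv_chain_continuous_on
      by (intro compact_continuous_image) (auto simp: step_chain_def)
    then obtain B where B: "\<forall>t\<in>{0..1}. \<bar>D i t\<bar> \<le> B"
      by (auto dest!: compact_imp_bounded simp: bounded_iff)
    have "\<bar>D i t\<bar> \<le> max B 1" for t
    proof (cases "t \<in> {0..1}")
      case False
      then show ?thesis
        using assms that by (cases "i = 0"; cases "t \<le> 0") (auto simp: step_chain_def)
    qed (use B in \<open>simp add: le_max_iff_disj\<close>)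
    then show ?thesis by blast
  qed
  then obtain B where B: "\<And>i t. i \<le> m \<Longrightarrow> \<bar>D i t\<bar> \<le> B i" by metis
  show thesis
  proof (rule that[of "max 1 (Max (B ` {..m}))"])
    fix i t assume "i \<le> m"
    then show "\<bar>D i t\<bar> \<le> max 1 (Max (B ` {..m}))"
      using B[of i t] Max_ge[of "B ` {..m}" "B i"]
      by (metis (no_types, lifting) atMost_iff finite_atMost finite_imageI imageI le_max_iff_disj order_trans)
  qed simp
qed

section \<open>Classical derivatives as weak derivatives\<close>

lemma integrable_lebesgue_on_continuous:
  fixes f :: "real \<Rightarrow> 'a::euclidean_space"
  assumes "continuous_on {0..T} f"
  shows "integrable (lebesgue_on {0..T}) f"
  using absolutely_integrable_continuous_real[OF assms] by (simp add: set_integrable_def integrable_restrict_space)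

text \<open>The definitions integrate against Lebesgue measure, while the fundamental theorem of
  calculus is stated for the gauge integral; this is the bridge.\<close>

lemma integral_lebesgue_on_continuous:
  fixes f :: "real \<Rightarrow> 'a::euclidean_space"
  assumes "continuous_on {0..T} f"
  shows "integral\<^sup>L (lebesgue_on {0..T}) f = integral {0..T} f"
  using lebesgue_integral_eq_integral[OF integrable_lebesgue_on_continuous[OF assms]] by simp

text \<open>The complement of the support \<open>K\<close> is open, so every derivative vanishes on
  it; both endpoints lie there because \<open>K\<close> is inside the open interval.\<close>

lemma test_functions_derivs:
  assumes "\<phi> \<in> test_functions T"
  shows "((deriv ^^ k) \<phi> has_real_derivative (deriv ^^ Suc k) \<phi> t) (at t)"
    and "continuous_on S ((deriv ^^ k) \<phi>)"
    and "(deriv ^^ k) \<phi> 0 = 0" "(deriv ^^ k) \<phi> T = 0"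
proof -
  show d: "((deriv ^^ k) \<phi> has_real_derivative (deriv ^^ Suc k) \<phi> t) (at t)" for k t
    using assms DERIV_deriv_iff_real_differentiable by (auto simp: test_functions_def)
  show "continuous_on S ((deriv ^^ k) \<phi>)"
    by (rule DERIV_continuous_on) (rule has_field_derivative_at_within[OF d])
  obtain K where K: "compact K" "K \<subseteq> {0<..<T}" "\<And>x. x \<notin> K \<Longrightarrow> \<phi> x = 0"
    using assms by (auto simp: test_functions_def)
  have van: "(deriv ^^ k) \<phi> x = 0" if "x \<notin> K" for k x
    using that
  proof (induction k arbitrary: x)
    case (Suc k)
    have "open (- K)" using K(1) by (simp add: compact_imp_closed open_Compl)
    then have "((deriv ^^ k) \<phi> has_real_derivative 0) (at x)"
      by (rule has_field_derivative_transform_within_open[OF DERIV_const]) (use Suc in simp_all)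
    then show ?case using d DERIV_unique by blast
  qed (use K in simp)
  show "(deriv ^^ k) \<phi> 0 = 0" "(deriv ^^ k) \<phi> T = 0"
    by (rule van; use K(2) in auto)+
qed

text \<open>Integration by parts moves the derivatives from the test function to \<open>D\<close>
  one at a time. Each move costs a sign and no boundary term. \<open>J a b\<close> has
  \<open>a\<close> derivatives on \<open>\<phi>\<close> and \<open>b\<close> on
  \<open>D\<close>.\<close>

lemma weak_deriv_deriv_chain:
  fixes D :: "nat \<Rightarrow> real \<Rightarrow> 'a::euclidean_space"
  assumes D: "deriv_chain m D" and "i \<le> m" and "T \<ge> 0"
  shows "weak_deriv T i (D 0) (D i)"
  unfolding weak_deriv_def
proof
  fix \<phi> assume \<phi>: "\<phi> \<in> test_functions T"
  define J where "J a b = integral {0..T} (\<lambda>t. (deriv ^^ a) \<phi> t *\<^sub>R D b t)" for a b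
  have cont: "continuous_on {0..T} (\<lambda>t. (deriv ^^ a) \<phi> t *\<^sub>R D b t)" if "b \<le> m" for a b
    by (rule continuous_on_scaleR[OF test_functions_derivs(2)[OF \<phi>] deriv_chain_continuous_on[OF D that]])
  have parts: "J (Suc a) b = - J a (Suc b)" if "b < m" for a b
  proof -
    have "((\<lambda>t. (deriv ^^ a) \<phi> t *\<^sub>R D (Suc b) t + (deriv ^^ Suc a) \<phi> t *\<^sub>R D b t) has_integral
        (deriv ^^ a) \<phi> T *\<^sub>R D b T - (deriv ^^ a) \<phi> 0 *\<^sub>R D b 0) {0..T}"
    proof (rule fundamental_theorem_of_calculus[OF \<open>T \<ge> 0\<close>])
      fix t assume "t \<in> {0..T}"
      show "((\<lambda>t. (deriv ^^ a) \<phi> t *\<^sub>R D b t) has_vector_derivative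
        (deriv ^^ a) \<phi> t *\<^sub>R D (Suc b) t + (deriv ^^ Suc a) \<phi> t *\<^sub>R D b t) (at t within {0..T})"
        by (rule has_vector_derivative_scaleR[OF
              has_field_derivative_at_within[OF test_functions_derivs(1)[OF \<phi>]]
              has_vector_derivative_at_within])
          (use D that in \<open>simp add: deriv_chain_def\<close>)
    qed
    then have "integral {0..T} (\<lambda>t. (deriv ^^ a) \<phi> t *\<^sub>R D (Suc b) t + (deriv ^^ Suc a) \<phi> t *\<^sub>R D b t) = 0"
      using test_functions_derivs(3,4)[OF \<phi>] by (simp add: integral_unique del: funpow.simps)
    moreover have "integral {0..T} (\<lambda>t. (deriv ^^ a) \<phi> t *\<^sub>R D (Suc b) t + (deriv ^^ Suc a) \<phi> t *\<^sub>R D b t)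
      = J a (Suc b) + J (Suc a) b"
      unfolding J_def
      by (rule integral_add; rule integrable_continuous_interval; rule cont) (use that in simp_all)
    ultimately show ?thesis by (simp add: eq_neg_iff_add_eq_0 add.commute)
  qed
  have "J i 0 = (- 1) ^ k *\<^sub>R J (i - k) k" if "k \<le> i" for k
    using that
  proof (induction k)
    case (Suc k)
    then have "J (i - k) k = - J (i - Suc k) (Suc k)"
      using parts[of k "i - Suc k"] \<open>i \<le> m\<close> by (simp add: Suc_diff_Suc)
    then show ?case using Suc by simp
  qed simp
  from this[of i] have "J i 0 = (- 1) ^ i *\<^sub>R J 0 i" by simp
  then show "(\<integral>t. (deriv ^^ i) \<phi> t *\<^sub>R D 0 t \<partial>lebesgue_on {0..T})
       = (- 1) ^ i *\<^sub>R (\<integral>t. \<phi> t *\<^sub>R D i t \<partial>lebesgue_on {0..T})"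
    using cont[of 0 i] cont[of i 0] \<open>i \<le> m\<close> by (simp add: integral_lebesgue_on_continuous J_def)
qed

lemma Linf_norm_le:
  assumes "continuous_on {0..T} g" "\<And>t. t \<in> {0..T} \<Longrightarrow> norm (g t) \<le> c"
  shows "Linf_norm T g \<le> ereal c" "g \<in> Linf T"
proof -
  have m: "g \<in> borel_measurable (lebesgue_on {0..T})"
    using borel_measurable_integrable integrable_lebesgue_on_continuous[OF assms(1)] by blast
  show *: "Linf_norm T g \<le> ereal c"
    unfolding Linf_norm_def
    using m assms(2) by (intro esssup_I AE_I2) auto
  show "g \<in> Linf T"
    using * m by (auto simp: Linf_def intro: le_less_trans)
qed

text \<open>The classical derivatives are the witnesses for the weak ones; \<open>D 0\<close> itself
  is bounded by compactness of the time interval.\<close>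

lemma deriv_chain_in_curves:
  fixes D :: "nat \<Rightarrow> real \<Rightarrow> real ^ 'n::finite"
  assumes D: "deriv_chain m D" and "T \<ge> 0"
    and le: "\<And>i t. i \<in> {1..m} \<Longrightarrow> norm (D i t) \<le> \<alpha> i"
  shows "(\<lambda>t. torus_proj (D 0 t)) \<in> curves m \<alpha> T"
proof -
  have c: "continuous_on {0..T} (D i)" if "i \<le> m" for i
    using deriv_chain_continuous_on[OF D that] .
  then have "bounded (D 0 ` {0..T})"
    by (intro compact_imp_bounded compact_continuous_image) auto
  then obtain B where "\<forall>t\<in>{0..T}. norm (D 0 t) \<le> B"
    by (auto simp: bounded_iff)
  then have "D 0 \<in> Linf T"
    using Linf_norm_le(2) c by blast
  moreover have "D i \<in> Linf T \<and> weak_deriv T i (D 0) (D i) \<and> Linf_norm T (D i) \<le> ereal (\<alpha> i)"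
    if "i \<in> {1..m}" for i
    using Linf_norm_le[of T "D i" "\<alpha> i"] weak_deriv_deriv_chain[OF D _ \<open>T \<ge> 0\<close>, of i] c[of i] le[OF that] that
    by auto
  ultimately show ?thesis
    unfolding curves_def Sobolev_inf_def using c[of 0] by blast
qed

section \<open>Topology and Lebesgue measure of the torus\<close>

lemma torus_proj_add: "torus_proj (a + b) = torus_proj a + torus_proj b"
  by (simp add: plus_torus.abs_eq)

lemma torus_proj_diff: "torus_proj (a - b) = torus_proj a - torus_proj b"
  by (simp add: minus_torus.abs_eq)

lemma continuous_on_torus_proj: "continuous_on S torus_proj"
  unfolding continuous_on_iff by (meson dist_torus_proj_le le_less_trans)

lemma continuous_on_torusI:
  assumes "continuous_on UNIV (\<lambda>a. f (torus_proj a))"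
  shows "continuous_on UNIV f"
  using assms unfolding continuous_on_open_vimage[OF open_UNIV] open_torus_iff
  by (simp add: vimage_def)

lemma dist_torus_eq_Inf: "dist x y = Inf (torus_dists x y)"
  by (simp only: dist_torus_def torus_dists_def)

text \<open>A point within \<open>e\<close> of \<open>x\<close> has a representative within
  \<open>e\<close> of any prescribed representative of \<open>x\<close>
  (\<open>torus_dists_lessD\<close>), so the projection carries balls onto balls.\<close>

lemma open_image_torus_proj:
  assumes "open U"
  shows "open (torus_proj ` U)"
  unfolding open_dist
proof
  fix x assume "x \<in> torus_proj ` U"
  then obtain a where a: "x = torus_proj a" "a \<in> U" by blast
  then obtain e where e: "e > 0" "ball a e \<subseteq> U"
    using assms openE by blast
  have "y \<in> torus_proj ` U" if y: "dist y x < e" for y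
  proof -
    have "Inf (torus_dists x y) < e"
      using y by (metis dist_commute dist_torus_eq_Inf)
    then obtain b where b: "torus_proj b = y" "dist a b < e"
      using torus_dists_lessD[OF _ a(1)[symmetric]] by blast
    then have "b \<in> U" using e(2) by (simp add: subset_eq)
    then show ?thesis using b(1) by blast
  qed
  then show "\<exists>e>0. \<forall>y. dist y x < e \<longrightarrow> y \<in> torus_proj ` U"
    using e by blast
qed


lemma topological_basis_torus:
  assumes B: "topological_basis (B :: (real ^ 'a::finite) set set)"
  shows "topological_basis ((`) torus_proj ` B)"
proof (rule topological_basisI)
  fix B' assume "B' \<in> (`) torus_proj ` B"
  then show "open B'"
    using B by (auto intro: open_image_torus_proj topological_basis_open)
next
  fix V :: "'a torus set" and x assume V: "open V" "x \<in> V"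
  obtain a where a: "torus_proj a = x" using torus_proj_surj by blast
  have V': "open (torus_proj -` V)" "a \<in> torus_proj -` V"
    using V a by (auto simp: open_torus_iff)
  obtain U where U: "U \<in> B" "a \<in> U" "U \<subseteq> torus_proj -` V"
    by (rule topological_basisE[OF B V'])
  show "\<exists>B'\<in>(`) torus_proj ` B. x \<in> B' \<and> B' \<subseteq> V"
  proof (intro bexI conjI)
    show "x \<in> torus_proj ` U" using U(2) a by (metis imageI)
    show "torus_proj ` U \<subseteq> V" using U(3) by (simp add: image_subset_iff_subset_vimage)
    show "torus_proj ` U \<in> (`) torus_proj ` B" using U(1) by (rule imageI)
  qed
qed

text \<open>Second countability makes the Borel sets of the product of two tori the product
  sigma-algebra, as the use of Fubini for convolutions requires.\<close>

instance torus :: (finite) second_countable_topology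
proof
  obtain B :: "(real ^ 'a) set set" where B: "countable B" "topological_basis B"
    using ex_countable_basis by blast
  show "\<exists>B :: 'a torus set set. countable B \<and> open = generate_topology B"
    using B(1) topological_basis_imp_subbasis[OF topological_basis_torus[OF B(2)]]
    by (intro exI[of _ "(`) torus_proj ` B"]) simp
qed

section \<open>The unit cube as a fundamental domain; compactness and continuity of the group
  operations\<close>

definition unit_cube :: "(real ^ 'n) set" where
  "unit_cube = {x. \<forall>i. 0 \<le> x $ i \<and> x $ i < 1}"

definition vec_of_int :: "int ^ 'n \<Rightarrow> real ^ 'n" where
  "vec_of_int k = (\<chi> i. of_int (k $ i))"

lemma torus_proj_vec_of_int: "torus_proj (vec_of_int k + x) = torus_proj x"
  by (simp add: torus_proj_eq_iff torus_eq_def vec_of_int_def)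

text \<open>The equivalence yields two facts at once: integer translates of the cube cover space,
  and they are disjoint.\<close>

lemma diff_vec_of_int_in_unit_cube_iff:
  "x - vec_of_int k \<in> unit_cube \<longleftrightarrow> k = (\<chi> i. \<lfloor>x $ i\<rfloor>)"
proof -
  have "0 \<le> x $ i - of_int (k $ i) \<and> x $ i - of_int (k $ i) < 1 \<longleftrightarrow> k $ i = \<lfloor>x $ i\<rfloor>" for i
    by linarith
  then show ?thesis by (simp add: unit_cube_def vec_of_int_def vec_eq_iff)
qed

lemma vec_of_int_add_in_unit_cube_iff:
  "vec_of_int k + x \<in> unit_cube \<longleftrightarrow> k = (\<chi> i. - \<lfloor>x $ i\<rfloor>)"
proof -
  have "0 \<le> of_int (k $ i) + x $ i \<and> of_int (k $ i) + x $ i < 1 \<longleftrightarrow> k $ i = - \<lfloor>x $ i\<rfloor>" for i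
    by linarith
  then show ?thesis by (simp add: unit_cube_def vec_of_int_def vec_eq_iff)
qed

lemma ex_unit_cube_rep:
  obtains a where "a \<in> unit_cube" "torus_proj a = x"
proof -
  obtain b where b: "torus_proj b = x" using torus_proj_surj by blast
  define k where "k = (\<chi> i. - \<lfloor>b $ i\<rfloor>)"
  show thesis
    by (rule that[of "vec_of_int k + b"])
      (use b in \<open>simp_all add: k_def vec_of_int_add_in_unit_cube_iff torus_proj_vec_of_int\<close>)
qed

lemma compact_UNIV_torus: "compact (UNIV :: ('n::finite) torus set)"
proof -
  have "torus_proj ` cbox 0 1 = (UNIV :: 'n torus set)"
  proof -
    have "x \<in> torus_proj ` cbox 0 1" for x :: "'n torus"
      by (rule ex_unit_cube_rep[of x]) (auto simp: unit_cube_def mem_box_cart intro!: less_imp_le image_eqI)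
    then show ?thesis by blast
  qed
  then show ?thesis
    using compact_continuous_image[OF continuous_on_torus_proj compact_cbox] by metis
qed

text \<open>Subtracting representatives of \<open>x\<close> and \<open>y\<close> from one
  representative of \<open>z\<close> preserves their distance, so every element of
  \<open>torus_dists x y\<close> bounds the left side. The reflected form is the one that a kernel
  \<open>h (z - y)\<close> calls for.\<close>

lemma dist_torus_diff_left: "dist (z - x) (z - y) \<le> dist x y" for x y z :: "('n::finite) torus"
proof -
  have "dist (z - x) (z - y) \<le> d" if d: "d \<in> torus_dists x y" for d
  proof -
    obtain a b where ab: "torus_proj a = x" "torus_proj b = y" "d = dist a b"
      using d by (auto simp: torus_dists_def)
    obtain c where c: "torus_proj c = z" using torus_proj_surj by blast
    have "dist (z - x) (z - y) \<le> dist (c - a) (c - b)"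
      using dist_torus_proj_le[of "c - a" "c - b"] by (simp add: torus_proj_diff ab c)
    also have "\<dots> = d" by (simp add: ab(3) dist_norm norm_minus_commute)
    finally show ?thesis .
  qed
  then show ?thesis
    unfolding dist_torus_eq_Inf[of x y]
    by (intro cInf_greatest torus_dists_nonempty)
qed

text \<open>A translation is the composition of two reflections, neither of which increases
  distances; the inverse translation gives the reverse inequality.\<close>

lemma dist_torus_add_left: "dist (z + x) (z + y) = dist x y" for x y z :: "('n::finite) torus"
proof -
  have le: "dist (z + x) (z + y) \<le> dist x y" for x y z :: "'n torus"
    using dist_torus_diff_left[of z "- x" "- y"] dist_torus_diff_left[of 0 x y] by simp
  show ?thesis using le[of z x y] le[of "- z" "z + x" "z + y"] by simp
qed

lemma continuous_on_torus_diff: "continuous_on UNIV (\<lambda>(x, y). x - y :: ('n::finite) torus)"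
proof -
  have "dist (x - y) (x' - y') \<le> dist x x' + dist y y'" for x y x' y' :: "'n torus"
  proof -
    have "dist (x - y) (x' - y') \<le> dist (x - y) (x' - y) + dist (x' - y) (x' - y')"
      by (rule dist_triangle)
    also have "dist (x - y) (x' - y) = dist x x'"
      using dist_torus_add_left[of "- y" x x'] by (simp add: algebra_simps)
    finally show ?thesis using dist_torus_diff_left[of x' y y'] by simp
  qed
  then have le: "dist (fst p - snd p) (fst q - snd q) \<le> dist (fst p) (fst q) + dist (snd p) (snd q)"
    for p q :: "'n torus \<times> 'n torus" by blast
  show ?thesis
    unfolding continuous_on_iff case_prod_unfold
  proof (intro ballI allI impI exI conjI)
    fix p q :: "'n torus \<times> 'n torus" and e :: real assume "0 < e" "dist q p < e / 2"
    then show "dist (fst q - snd q) (fst p - snd p) < e"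
      using le[of q p] dist_fst_le[of q p] dist_snd_le[of q p] by linarith
  qed simp
qed

lemma bounded_torus_continuous:
  fixes f :: "('n::finite) torus \<Rightarrow> 'a::real_normed_vector"
  assumes "continuous_on UNIV f"
  shows "\<exists>B. \<forall>x. norm (f x) \<le> B"
proof -
  have "bounded (range f)"
    using compact_continuous_image[OF assms compact_UNIV_torus] by (rule compact_imp_bounded)
  then obtain B where "\<forall>y\<in>range f. norm y \<le> B" unfolding bounded_iff by blast
  then show ?thesis by blast
qed

lemma integrable_torus_continuous:
  fixes f :: "('n::finite) torus \<Rightarrow> 'a::{banach, second_countable_topology}"
  assumes "continuous_on UNIV f" "finite_measure M" "sets M = sets borel"
  shows "integrable M f"
proof -
  interpret finite_measure M by fact
  obtain B where "\<forall>x. norm (f x) \<le> B" using bounded_torus_continuous[OF assms(1)] ..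
  then show ?thesis
    using borel_measurable_continuous_onI[OF assms(1)] assms(3)
    by (intro integrable_const_bound[of _ B]) (auto cong: measurable_cong_sets)
qed

section \<open>Translation invariance of Lebesgue measure on the torus\<close>

lemma unit_cube_borel [measurable]: "unit_cube \<in> sets borel"
  unfolding unit_cube_def by measurable

lemma torus_proj_borel_measurable [measurable]: "torus_proj \<in> borel_measurable borel"
  by (rule borel_measurable_continuous_onI[OF continuous_on_torus_proj])

lemma sets_torus_lebesgue [simp, measurable_cong]: "sets torus_lebesgue = sets borel"
  by (simp add: torus_lebesgue_def)

lemma space_torus_lebesgue [simp]: "space torus_lebesgue = UNIV"
  by (simp add: torus_lebesgue_def)

lemma emeasure_torus_lebesgue:
  assumes "B \<in> sets borel"
  shows "emeasure torus_lebesgue B = emeasure lborel {x\<in>unit_cube. torus_proj x \<in> B}"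
proof -
  have "emeasure torus_lebesgue B =
      emeasure (restrict_space lborel unit_cube) (torus_proj -` B \<inter> space (restrict_space lborel unit_cube))"
    unfolding torus_lebesgue_def unit_cube_def[symmetric]
    by (rule emeasure_distr) (use assms in \<open>auto intro: measurable_restrict_space1\<close>)
  also have "torus_proj -` B \<inter> space (restrict_space lborel unit_cube) = {x\<in>unit_cube. torus_proj x \<in> B}"
    by (auto simp: space_restrict_space)
  finally show ?thesis
    by (simp add: emeasure_restrict_space unit_cube_borel)
qed

lemma emeasure_lborel_unit_cube: "emeasure lborel (unit_cube :: (real ^ 'n::finite) set) = 1"
proof (rule antisym)
  have "emeasure lborel (unit_cube :: (real ^ 'n) set) \<le> emeasure lborel (cbox 0 1 :: (real ^ 'n) set)"
    by (rule emeasure_mono) (auto simp: unit_cube_def mem_box_cart less_imp_le)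
  also have "\<dots> = 1"
    by (subst emeasure_lborel_cbox) (auto intro!: prod.neutral simp: Basis_vec_def inner_axis)
  finally show "emeasure lborel (unit_cube :: (real ^ 'n) set) \<le> 1" .
  have "1 = emeasure lborel (box 0 1 :: (real ^ 'n) set)"
    by (subst emeasure_lborel_box) (auto intro!: prod.neutral simp: Basis_vec_def inner_axis)
  also have "\<dots> \<le> emeasure lborel (unit_cube :: (real ^ 'n) set)"
    by (rule emeasure_mono) (auto simp: unit_cube_def mem_box_cart less_imp_le)
  finally show "1 \<le> emeasure lborel (unit_cube :: (real ^ 'n) set)" .
qed

lemma prob_space_torus_lebesgue: "prob_space torus_lebesgue"
  by (rule prob_spaceI) (simp add: emeasure_torus_lebesgue emeasure_lborel_unit_cube)

lemma emeasure_lborel_vimage_plus: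
  assumes "A \<in> sets borel"
  shows "emeasure lborel {x. c + x \<in> A} = emeasure lborel A"
proof -
  have "emeasure lborel A = emeasure (distr lborel borel ((+) c)) A"
    by (simp add: lborel_distr_plus)
  also have "\<dots> = emeasure lborel ((+) c -` A \<inter> space lborel)"
    by (rule emeasure_distr) (use assms in auto)
  finally show ?thesis by (simp add: vimage_def)
qed

lemma emeasure_unit_cube_periodic:
  fixes E :: "(real ^ 'n::finite) set"
  assumes [measurable]: "E \<in> sets borel" and per: "\<And>k x. vec_of_int k + x \<in> E \<longleftrightarrow> x \<in> E"
  shows "emeasure lborel {x\<in>unit_cube. a + x \<in> E} = emeasure lborel (unit_cube \<inter> E)"
proof -
  \<comment> \<open>Cut the translated cube along the integer translates of the cube; moving the pieces back by
    \<open>- k\<close> reassembles the cube.\<close>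
  define V where "V k = {y. y - a \<in> unit_cube \<and> y \<in> E \<and> y - vec_of_int k \<in> unit_cube}" for k
  define W where "W k = {x. vec_of_int k + (x - a) \<in> unit_cube \<and> x \<in> E \<and> x \<in> unit_cube}" for k
  have [measurable]: "V k \<in> sets borel" "W k \<in> sets borel" for k
    unfolding V_def W_def by measurable
  have VW: "emeasure lborel (V k) = emeasure lborel (W k)" for k
  proof -
    \<comment> \<open>Periodicity removes the shift from the condition on \<open>E\<close>, so
      \<open>W k\<close> is exactly \<open>V k\<close> moved by \<open>- k\<close>.\<close>
    have "{x. vec_of_int k + x \<in> V k} = W k"
      by (simp add: V_def W_def per add_diff_eq)
    then show ?thesis using emeasure_lborel_vimage_plus[of "V k" "vec_of_int k"] by simp
  qed
  have "emeasure lborel {x\<in>unit_cube. a + x \<in> E} = emeasure lborel {y. y - a \<in> unit_cube \<and> y \<in> E}"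
    by (subst emeasure_lborel_vimage_plus[of _ a, symmetric]) (auto intro!: arg_cong2[of _ _ _ _ emeasure])
  also have "{y. y - a \<in> unit_cube \<and> y \<in> E} = (\<Union>k. V k)"
    by (auto simp: V_def diff_vec_of_int_in_unit_cube_iff)
  also have "emeasure lborel (\<Union>k. V k) = (\<integral>\<^sup>+k. emeasure lborel (V k) \<partial>count_space UNIV)"
  proof (rule emeasure_UN_countable)
    show "disjoint_family_on V UNIV"
      by (auto simp: disjoint_family_on_def V_def diff_vec_of_int_in_unit_cube_iff)
  qed simp_all
  also have "\<dots> = (\<integral>\<^sup>+k. emeasure lborel (W k) \<partial>count_space UNIV)"
    by (simp add: VW)
  also have "\<dots> = emeasure lborel (\<Union>k. W k)"
  proof (rule emeasure_UN_countable[symmetric])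
    show "disjoint_family_on W UNIV"
      by (auto simp: disjoint_family_on_def W_def vec_of_int_add_in_unit_cube_iff)
  qed simp_all
  also have "(\<Union>k. W k) = unit_cube \<inter> E"
    by (auto simp: W_def vec_of_int_add_in_unit_cube_iff)
  finally show ?thesis .
qed

lemma continuous_on_torus_add: "continuous_on S (\<lambda>x. a + x :: ('n::finite) torus)"
  unfolding continuous_on_iff dist_torus_add_left by blast

text \<open>A Borel set of the torus lifts to a periodic set of vectors and the shift
  \<open>a\<close> to a representative \<open>c\<close>, which reduces the claim to
  \<open>emeasure_unit_cube_periodic\<close>.\<close>

lemma torus_lebesgue_translation:
  "distr torus_lebesgue borel (\<lambda>x. a + x) = (torus_lebesgue :: ('n::finite) torus measure)"
proof (rule measure_eqI)
  fix B assume "B \<in> sets (distr torus_lebesgue borel (\<lambda>x. a + x))"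
  then have B [measurable]: "B \<in> sets borel" by simp
  have [measurable]: "(\<lambda>x. a + x) \<in> borel_measurable borel"
    by (rule borel_measurable_continuous_onI[OF continuous_on_torus_add])
  obtain c where c: "torus_proj c = a" using torus_proj_surj by blast
  define E where "E = torus_proj -` B"
  have "E = torus_proj -` B \<inter> space borel" by (simp add: E_def)
  then have "E \<in> sets borel" using measurable_sets[OF torus_proj_borel_measurable B] by simp
  have "emeasure (distr torus_lebesgue borel (\<lambda>x. a + x)) B = emeasure torus_lebesgue {x. a + x \<in> B}"
    by (subst emeasure_distr) (auto simp: vimage_def)
  also have "\<dots> = emeasure lborel {x\<in>unit_cube. c + x \<in> E}"
    by (subst emeasure_torus_lebesgue) (auto simp: E_def torus_proj_add c)
  also have "\<dots> = emeasure lborel (unit_cube \<inter> E)"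
    by (rule emeasure_unit_cube_periodic[OF \<open>E \<in> sets borel\<close>]) (simp add: E_def torus_proj_vec_of_int)
  also have "\<dots> = emeasure torus_lebesgue B"
    by (simp add: emeasure_torus_lebesgue E_def Int_def)
  finally show "emeasure (distr torus_lebesgue borel (\<lambda>x. a + x)) B = emeasure torus_lebesgue B" .
qed simp

lemma integral_torus_translation:
  fixes f :: "('n::finite) torus \<Rightarrow> 'a::{banach, second_countable_topology}"
  assumes [measurable]: "f \<in> borel_measurable borel"
  shows "(\<integral>x. f (a + x) \<partial>torus_lebesgue) = (\<integral>x. f x \<partial>torus_lebesgue)"
proof -
  have [measurable]: "(\<lambda>x. a + x) \<in> borel_measurable borel"
    by (rule borel_measurable_continuous_onI[OF continuous_on_torus_add])
  show ?thesis
    by (subst (2) torus_lebesgue_translation[of a, symmetric], subst integral_distr) simp_all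
qed

section \<open>Fourier coefficients and weak convergence\<close>

lemma torus_char_add: "torus_char \<xi> (x + y) = torus_char \<xi> x * torus_char \<xi> y"
  by transfer (simp add: exp_add [symmetric] distrib_left sum.distrib)

lemma torus_char_add_freq: "torus_char (\<xi> + \<eta>) x = torus_char \<xi> x * torus_char \<eta> x"
  by transfer (simp add: exp_add [symmetric] distrib_left distrib_right sum.distrib)

lemma torus_char_uminus_freq: "torus_char (- \<xi>) x = cnj (torus_char \<xi> x)"
  by transfer (simp add: exp_cnj sum_negf)

lemma torus_char_zero_freq: "torus_char 0 x = 1"
  by transfer simp

lemma norm_torus_char: "norm (torus_char \<xi> x) = 1"
  by transfer simp

lemma continuous_on_torus_char: "continuous_on UNIV (torus_char \<xi>)"
  by (rule continuous_on_torusI) (auto simp: torus_char.abs_eq intro!: continuous_intros)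

text \<open>Substituting \<open>y + x\<close> for \<open>x\<close> turns the translation into a
  factor, because characters are multiplicative.\<close>

lemma integral_torus_char_translate:
  assumes h: "continuous_on UNIV h"
  shows "(\<integral>x. torus_char \<xi> x * of_real (h (x - y)) \<partial>torus_lebesgue) = torus_char \<xi> y * torus_fourier h \<xi>"
proof -
  have [measurable]: "(\<lambda>x. x - y) \<in> borel_measurable borel"
    using borel_measurable_continuous_onI[OF continuous_on_torus_add[of UNIV "- y"]] by simp
  note [measurable] = borel_measurable_continuous_onI[OF h]
    borel_measurable_continuous_onI[OF continuous_on_torus_char]
  have "(\<integral>x. torus_char \<xi> x * of_real (h (x - y)) \<partial>torus_lebesgue) =
      (\<integral>x. torus_char \<xi> (y + x) * of_real (h (y + x - y)) \<partial>torus_lebesgue)"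
    by (rule integral_torus_translation[symmetric]) measurable
  also have "\<dots> = torus_char \<xi> y * torus_fourier h \<xi>"
    by (simp add: torus_char_add torus_fourier_def mult.assoc)
  finally show ?thesis .
qed

lemma continuous_on_torus_diff_pair:
  assumes "continuous_on UNIV (h :: ('n::finite) torus \<Rightarrow> real)"
  shows "continuous_on UNIV (\<lambda>(x, y). h (x - y))"
  using continuous_on_compose2[OF assms continuous_on_torus_diff] by (simp add: case_prod_unfold)

text \<open>This is the convolution theorem. After the exchange of integrals, the inner one is the
  Fourier coefficient of a translate of \<open>h\<close>; boundedness of \<open>h\<close> gives
  integrability on the product of the two probability spaces.\<close>

lemma torus_fourier_conv_measure:
  fixes h :: "('n::finite) torus \<Rightarrow> real"
  assumes h: "continuous_on UNIV h" and \<mu>: "prob_space \<mu>" "sets \<mu> = sets borel"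
  shows "(\<integral>x. torus_char \<xi> x * of_real (conv_measure h \<mu> x) \<partial>torus_lebesgue)
    = torus_fourier h \<xi> * (\<integral>y. torus_char \<xi> y \<partial>\<mu>)"
proof -
  interpret \<mu>: prob_space \<mu> by fact
  interpret L: prob_space "torus_lebesgue :: 'n torus measure" by (rule prob_space_torus_lebesgue)
  interpret P: pair_prob_space "torus_lebesgue :: 'n torus measure" \<mu> ..
  have cont: "continuous_on UNIV (\<lambda>(x, y). torus_char \<xi> x * of_real (h (x - y)))"
    unfolding case_prod_unfold
    by (rule continuous_on_mult[OF
          continuous_on_compose2[OF continuous_on_torus_char continuous_on_fst[OF continuous_on_id]]
          continuous_on_of_real[OF continuous_on_torus_diff_pair[OF h, unfolded case_prod_unfold]]]) simp
  obtain B where B: "\<forall>x. norm (h x) \<le> B" using bounded_torus_continuous[OF h] ..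
  \<comment> \<open>Identifies the product sigma-algebra with the Borel sets of the product space,
    so that continuity yields joint measurability.\<close>
  have sets: "sets (torus_lebesgue \<Otimes>\<^sub>M \<mu>) = sets (borel :: ('n torus \<times> 'n torus) measure)"
    unfolding borel_prod[symmetric] by (rule sets_pair_measure_cong) (simp_all add: \<mu>)
  have int: "integrable (torus_lebesgue \<Otimes>\<^sub>M \<mu>) (\<lambda>(x, y). torus_char \<xi> x * of_real (h (x - y)))"
  proof (rule P.P.integrable_const_bound)
    show "AE p in torus_lebesgue \<Otimes>\<^sub>M \<mu>. norm (case p of (x, y) \<Rightarrow> torus_char \<xi> x * of_real (h (x - y))) \<le> B"
      using B by (simp add: case_prod_unfold norm_mult norm_torus_char)
    show "(\<lambda>(x, y). torus_char \<xi> x * of_real (h (x - y))) \<in> borel_measurable (torus_lebesgue \<Otimes>\<^sub>M \<mu>)"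
      using borel_measurable_continuous_onI[OF cont] measurable_cong_sets[OF sets refl] by blast
  qed
  have "(\<integral>x. torus_char \<xi> x * of_real (conv_measure h \<mu> x) \<partial>torus_lebesgue) =
      (\<integral>x. (\<integral>y. torus_char \<xi> x * of_real (h (x - y)) \<partial>\<mu>) \<partial>torus_lebesgue)"
    by (simp add: conv_measure_def)
  also have "\<dots> = (\<integral>y. (\<integral>x. torus_char \<xi> x * of_real (h (x - y)) \<partial>torus_lebesgue) \<partial>\<mu>)"
    by (rule P.Fubini_integral[OF int, symmetric])
  also have "\<dots> = (\<integral>y. torus_char \<xi> y * torus_fourier h \<xi> \<partial>\<mu>)"
    by (simp only: integral_torus_char_translate[OF h])
  also have "\<dots> = torus_fourier h \<xi> * (\<integral>y. torus_char \<xi> y \<partial>\<mu>)"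
    by (simp add: mult.commute)
  finally show ?thesis .
qed

lemma integrable_translate_kernel:
  fixes h :: "('n::finite) torus \<Rightarrow> real"
  assumes "continuous_on UNIV h" and "prob_space \<mu>" "sets \<mu> = sets borel"
  shows "integrable \<mu> (\<lambda>y. h (x - y))"
proof (rule integrable_torus_continuous)
  have "continuous_on UNIV (\<lambda>y. x - y)"
    unfolding continuous_on_iff using dist_torus_diff_left le_less_trans by blast
  then show "continuous_on UNIV (\<lambda>y. h (x - y))"
    by (rule continuous_on_compose2[OF assms(1)]) simp
qed (use assms in \<open>simp_all add: prob_space.finite_measure\<close>)

text \<open>Averaging translates of \<open>h\<close> against total mass 1 keeps the Lipschitz
  constant. The resulting continuity makes the integrand of \<open>N_diff\<close>
  integrable.\<close>

lemma lipschitz_conv_measure: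
  fixes h :: "('n::finite) torus \<Rightarrow> real"
  assumes h: "L-lipschitz_on UNIV h" and \<mu>: "prob_space \<mu>" "sets \<mu> = sets borel"
  shows "L-lipschitz_on UNIV (conv_measure h \<mu>)"
proof (rule lipschitz_onI)
  interpret prob_space \<mu> by fact
  note int = integrable_translate_kernel[OF lipschitz_on_continuous_on[OF h] \<mu>]
  fix x x' :: "'n torus"
  have "\<bar>h (x - y) - h (x' - y)\<bar> \<le> L * dist x x'" for y
  proof -
    have "dist (x - y) (x' - y) = dist x x'"
      using dist_torus_add_left[of "- y" x x'] by (simp add: algebra_simps)
    then show ?thesis
      using lipschitz_onD[OF h, of "x - y" "x' - y"] by (simp add: dist_real_def)
  qed
  moreover have I: "integrable \<mu> (\<lambda>y. h (x - y) - h (x' - y))"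
    by (rule Bochner_Integration.integrable_diff[OF int int])
  ultimately have "(\<integral>y. \<bar>h (x - y) - h (x' - y)\<bar> \<partial>\<mu>) \<le> L * dist x x'"
    by (intro integral_le_const integrable_abs AE_I2)
  moreover have "conv_measure h \<mu> x - conv_measure h \<mu> x' = (\<integral>y. h (x - y) - h (x' - y) \<partial>\<mu>)"
    unfolding conv_measure_def by (rule Bochner_Integration.integral_diff[OF int int, symmetric])
  ultimately show "dist (conv_measure h \<mu> x) (conv_measure h \<mu> x') \<le> L * dist x x'"
    unfolding dist_real_def using integral_abs_bound order_trans by metis
qed (rule lipschitz_on_nonneg[OF h])

text \<open>Cauchy-Schwarz against the constant 1, obtained from the fact that the variance of
  \<bar>g\<bar> is nonnegative.\<close>

lemma (in prob_space) integral_abs_le_sqrt: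
  fixes g :: "'a \<Rightarrow> real"
  assumes "integrable M g" "integrable M (\<lambda>x. (g x)\<^sup>2)"
  shows "(\<integral>x. \<bar>g x\<bar> \<partial>M) \<le> sqrt (\<integral>x. (g x)\<^sup>2 \<partial>M)"
proof (rule real_le_rsqrt)
  have "0 \<le> variance (\<lambda>x. \<bar>g x\<bar>)" by (rule variance_positive)
  also have "\<dots> = (\<integral>x. (g x)\<^sup>2 \<partial>M) - (\<integral>x. \<bar>g x\<bar> \<partial>M)\<^sup>2"
    using assms by (subst variance_eq) simp_all
  finally show "(\<integral>x. \<bar>g x\<bar> \<partial>M)\<^sup>2 \<le> (\<integral>x. (g x)\<^sup>2 \<partial>M)" by simp
qed

text \<open>The left side is the modulus of a Fourier coefficient of
  \<open>conv_measure h \<mu> - conv_measure h \<nu>\<close>. Characters have modulus 1, so the L1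
  norm bounds it, and with total mass 1 the L2 norm bounds the L1 norm.\<close>

lemma torus_fourier_N_diff_bound:
  fixes h :: "('n::finite) torus \<Rightarrow> real"
  assumes h: "L-lipschitz_on UNIV h"
    and \<mu>: "prob_space \<mu>" "sets \<mu> = sets borel" and \<nu>: "prob_space \<nu>" "sets \<nu> = sets borel"
  shows "norm (torus_fourier h \<xi>) * norm ((\<integral>y. torus_char \<xi> y \<partial>\<mu>) - (\<integral>y. torus_char \<xi> y \<partial>\<nu>)) \<le> N_diff h \<mu> \<nu>"
proof -
  interpret prob_space "torus_lebesgue :: 'n torus measure" by (rule prob_space_torus_lebesgue)
  have int: "integrable torus_lebesgue f" if "continuous_on UNIV f"
    for f :: "'n torus \<Rightarrow> 'b::{banach, second_countable_topology}"
    using that finite_measure_axioms by (rule integrable_torus_continuous) simp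
  note ch = lipschitz_on_continuous_on[OF h]
  note c\<mu> = lipschitz_on_continuous_on[OF lipschitz_conv_measure[OF h \<mu>]]
  note c\<nu> = lipschitz_on_continuous_on[OF lipschitz_conv_measure[OF h \<nu>]]
  define g where "g x = conv_measure h \<mu> x - conv_measure h \<nu> x" for x
  have g: "continuous_on UNIV g" unfolding g_def by (rule continuous_on_diff[OF c\<mu> c\<nu>])
  have cc: "continuous_on UNIV (\<lambda>x. torus_char \<xi> x * of_real (f x))" if "continuous_on UNIV f" for f
    by (rule continuous_on_mult[OF continuous_on_torus_char continuous_on_of_real[OF that]])
  have "torus_fourier h \<xi> * ((\<integral>y. torus_char \<xi> y \<partial>\<mu>) - (\<integral>y. torus_char \<xi> y \<partial>\<nu>)) =
    (\<integral>x. torus_char \<xi> x * of_real (g x) \<partial>torus_lebesgue)"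
    unfolding right_diff_distrib torus_fourier_conv_measure[OF ch \<mu>, symmetric]
      torus_fourier_conv_measure[OF ch \<nu>, symmetric]
    by (subst Bochner_Integration.integral_diff[OF int[OF cc[OF c\<mu>]] int[OF cc[OF c\<nu>]], symmetric])
      (simp add: g_def right_diff_distrib)
  then have "norm (torus_fourier h \<xi>) * norm ((\<integral>y. torus_char \<xi> y \<partial>\<mu>) - (\<integral>y. torus_char \<xi> y \<partial>\<nu>))
    = norm (\<integral>x. torus_char \<xi> x * of_real (g x) \<partial>torus_lebesgue)"
    by (simp add: norm_mult[symmetric])
  also have "\<dots> \<le> (\<integral>x. norm (torus_char \<xi> x * of_real (g x)) \<partial>torus_lebesgue)"
    by (rule integral_norm_bound)
  also have "\<dots> = (\<integral>x. \<bar>g x\<bar> \<partial>torus_lebesgue)"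
    by (simp add: norm_mult norm_torus_char)
  also have "\<dots> \<le> sqrt (\<integral>x. (g x)\<^sup>2 \<partial>torus_lebesgue)"
    by (rule integral_abs_le_sqrt; rule int) (use g continuous_on_power[OF g] in simp_all)
  finally show ?thesis by (simp add: N_diff_def g_def)
qed

text \<open>Real-valued, to fit the real Stone-Weierstrass theorem; the complex factor
  \<open>c\<close> provides both cosines and sines.\<close>

inductive trig_poly :: "(('n::finite) torus \<Rightarrow> real) \<Rightarrow> bool" where
  trig_poly_char: "trig_poly (\<lambda>x. Re (c * torus_char \<xi> x))"
| trig_poly_add: "trig_poly f \<Longrightarrow> trig_poly g \<Longrightarrow> trig_poly (\<lambda>x. f x + g x)"

lemma trig_poly_continuous: "trig_poly f \<Longrightarrow> continuous_on UNIV f"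
proof (induction rule: trig_poly.induct)
  case (trig_poly_char c \<xi>)
  show ?case
    by (rule continuous_on_Re[OF continuous_on_mult_left[OF continuous_on_torus_char]])
qed (rule continuous_on_add)

text \<open>The product-to-sum formula: the real part of u times that of v is the real part of (u v
  + u cnj v)/2, and conjugating a character negates its frequency.\<close>

lemma trig_poly_char_mult:
  "trig_poly g \<Longrightarrow> trig_poly (\<lambda>x. Re (c * torus_char \<xi> x) * g x)"
proof (induction rule: trig_poly.induct)
  case (trig_poly_char d \<eta>)
  have Re_mult: "Re u * Re v = Re (u * v / 2) + Re (u * cnj v / 2)" for u v :: complex
    by (simp add: add_divide_distrib diff_divide_distrib)
  have "Re (c * torus_char \<xi> x) * Re (d * torus_char \<eta> x) =
      Re (c * d / 2 * torus_char (\<xi> + \<eta>) x) + Re (c * cnj d / 2 * torus_char (\<xi> + - \<eta>) x)" for x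
  proof -
    have "c * torus_char \<xi> x * (d * torus_char \<eta> x) / 2 = c * d / 2 * torus_char (\<xi> + \<eta>) x"
      by (simp add: torus_char_add_freq)
    moreover have "c * torus_char \<xi> x * cnj (d * torus_char \<eta> x) / 2
        = c * cnj d / 2 * torus_char (\<xi> + - \<eta>) x"
      by (simp only: torus_char_add_freq torus_char_uminus_freq) simp
    ultimately show ?thesis
      using Re_mult[of "c * torus_char \<xi> x" "d * torus_char \<eta> x"] by metis
  qed
  then show ?case
    by (simp only:) (intro trig_poly.trig_poly_add trig_poly.trig_poly_char)
next
  case (trig_poly_add f g)
  then show ?case by (simp add: distrib_left trig_poly.trig_poly_add)
qed

lemma trig_poly_mult: "trig_poly f \<Longrightarrow> trig_poly g \<Longrightarrow> trig_poly (\<lambda>x. f x * g x)"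
proof (induction rule: trig_poly.induct)
  case (trig_poly_add f f')
  then show ?case by (simp add: distrib_right trig_poly.trig_poly_add)
qed (rule trig_poly_char_mult)

lemma trig_poly_const: "trig_poly (\<lambda>_. c)"
  using trig_poly_char[of "of_real c" 0] by (simp add: torus_char_zero_freq)

text \<open>Representatives of distinct points differ by a non-integer in some coordinate
  \<open>i\<close>, which the character of frequency \<open>axis i 1\<close> detects.\<close>

lemma torus_char_separates:
  assumes "x \<noteq> y"
  obtains \<xi> where "torus_char \<xi> x \<noteq> torus_char \<xi> y"
proof -
  obtain a b where ab: "torus_proj a = x" "torus_proj b = y" using torus_proj_surj by metis
  then obtain i where i: "a $ i - b $ i \<notin> \<int>"
    using assms torus_proj_eq_iff[of a b] by (auto simp: torus_eq_def)
  have "torus_char (axis i 1) x \<noteq> torus_char (axis i 1) y"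
  proof
    assume eq: "torus_char (axis i 1) x = torus_char (axis i 1) y"
    have s: "(\<Sum>j\<in>UNIV. of_int (axis i 1 $ j) * z $ j) = z $ i" for z :: "real ^ 'a"
      by (simp add: axis_def if_distrib[of "\<lambda>u. of_int u * _"] cong: if_cong)
    obtain n :: int where "- 2 * \<i> * of_real pi * of_real (a $ i) = - 2 * \<i> * of_real pi * of_real (b $ i) + (of_int (2 * n) * pi) * \<i>"
      using eq unfolding ab[symmetric] torus_char.abs_eq s exp_eq by blast
    then have "- 2 * pi * (a $ i) = - 2 * pi * (b $ i) + 2 * n * pi"
      by (auto simp: complex_eq_iff)
    then have "pi * (a $ i - b $ i + n) = 0" by (simp add: algebra_simps)
    then have "a $ i - b $ i = of_int (- n)" by simp
    then show False using i by (metis Ints_of_int)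
  qed
  then show thesis by (rule that)
qed

lemma function_ring_trig_poly: "function_ring_on (Collect trig_poly) (UNIV :: ('n::finite) torus set)"
proof
  fix x y :: "'n torus" assume "x \<noteq> y"
  then obtain \<xi> where "torus_char \<xi> x \<noteq> torus_char \<xi> y" by (rule torus_char_separates)
  \<comment> \<open>The factor 1 extracts the real part and the factor \<open>- \<i>\<close> the
    imaginary part, so one of the two real functions separates the points.\<close>
  then have "Re (1 * torus_char \<xi> x) \<noteq> Re (1 * torus_char \<xi> y) \<or>
      Re (- \<i> * torus_char \<xi> x) \<noteq> Re (- \<i> * torus_char \<xi> y)"
    by (simp add: complex_eq_iff)
  then show "\<exists>f\<in>Collect trig_poly. f x \<noteq> f y"
    by (elim disjE) (erule bexI, rule CollectI, rule trig_poly_char)+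
qed (simp_all add: compact_UNIV_torus trig_poly_continuous trig_poly_add trig_poly_mult trig_poly_const)

lemma trig_poly_dense:
  fixes f :: "('n::finite) torus \<Rightarrow> real"
  assumes "continuous_on UNIV f" "e > 0"
  obtains g where "trig_poly g" "\<forall>x. \<bar>f x - g x\<bar> < e"
  using function_ring_on.Stone_Weierstrass_basic[OF function_ring_trig_poly assms] by auto

text \<open>No Fourier coefficient of \<open>h\<close> vanishes, so each can be divided out, at a
  speed that depends on the frequency; approximating by a single trigonometric polynomial involves
  only finitely many frequencies. The condition on \<open>\<mu> T\<close> is eventual because
  minimizers are given for positive \<open>T\<close> only.\<close>

lemma N_diff_tendsto_imp_weakly_converges:
  fixes h :: "('n::finite) torus \<Rightarrow> real"
  assumes h: "L-lipschitz_on UNIV h" "\<And>\<xi>. torus_fourier h \<xi> \<noteq> 0"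
    and \<mu>: "\<forall>\<^sub>F T in F. prob_space (\<mu> T) \<and> sets (\<mu> T) = sets borel"
    and \<pi>: "prob_space \<pi>" "sets \<pi> = sets borel"
    and lim: "((\<lambda>T. N_diff h (\<mu> T) \<pi>) \<longlongrightarrow> 0) F"
  shows "weakly_converges \<mu> \<pi> F"
proof -
  have int: "integrable M f" if "continuous_on UNIV f" "prob_space M \<and> sets M = sets borel"
    for M and f :: "'n torus \<Rightarrow> 'b::{banach, second_countable_topology}"
    using that integrable_torus_continuous[of f M] by (simp add: prob_space.finite_measure)
  have char: "((\<lambda>T. (\<integral>x. torus_char \<xi> x \<partial>\<mu> T)) \<longlongrightarrow> (\<integral>x. torus_char \<xi> x \<partial>\<pi>)) F" for \<xi>
  proof -
    have "((\<lambda>T. N_diff h (\<mu> T) \<pi> / norm (torus_fourier h \<xi>)) \<longlongrightarrow> 0) F"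
      using tendsto_divide[OF lim tendsto_const, of "norm (torus_fourier h \<xi>)"] h(2) by simp
    moreover have "\<forall>\<^sub>F T in F. norm ((\<integral>x. torus_char \<xi> x \<partial>\<mu> T) - (\<integral>x. torus_char \<xi> x \<partial>\<pi>))
        \<le> N_diff h (\<mu> T) \<pi> / norm (torus_fourier h \<xi>)"
      using \<mu>
    proof eventually_elim
      case (elim T)
      then have "norm (torus_fourier h \<xi>) * norm ((\<integral>x. torus_char \<xi> x \<partial>\<mu> T) - (\<integral>x. torus_char \<xi> x \<partial>\<pi>))
          \<le> N_diff h (\<mu> T) \<pi>"
        by (intro torus_fourier_N_diff_bound[OF h(1)] \<pi>) simp_all
      then show ?case using h(2)[of \<xi>] by (simp add: pos_le_divide_eq mult.commute)
    qed
    ultimately have "((\<lambda>T. (\<integral>x. torus_char \<xi> x \<partial>\<mu> T) - (\<integral>x. torus_char \<xi> x \<partial>\<pi>)) \<longlongrightarrow> 0) F"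
      by (rule Lim_null_comparison[rotated])
    then show ?thesis by (rule LIM_zero_cancel)
  qed
  have poly: "((\<lambda>T. (\<integral>x. g x \<partial>\<mu> T)) \<longlongrightarrow> (\<integral>x. g x \<partial>\<pi>)) F" if "trig_poly g" for g
    using that
  proof (induction rule: trig_poly.induct)
    case (trig_poly_char c \<xi>)
    have eq: "(\<integral>x. Re (c * torus_char \<xi> x) \<partial>M) = Re (c * (\<integral>x. torus_char \<xi> x \<partial>M))"
      if "prob_space M \<and> sets M = sets borel" for M
      using int[OF continuous_on_torus_char that, of \<xi>] by (subst integral_Re) simp_all
    have "((\<lambda>T. Re (c * (\<integral>x. torus_char \<xi> x \<partial>\<mu> T))) \<longlongrightarrow> Re (c * (\<integral>x. torus_char \<xi> x \<partial>\<pi>))) F"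
      by (intro tendsto_intros char)
    moreover have "\<forall>\<^sub>F T in F. Re (c * (\<integral>x. torus_char \<xi> x \<partial>\<mu> T)) = (\<integral>x. Re (c * torus_char \<xi> x) \<partial>\<mu> T)"
      using \<mu> by eventually_elim (rule eq[symmetric])
    ultimately show ?case
      using eq[of \<pi>] \<pi> by (simp add: tendsto_cong)
  next
    case (trig_poly_add f g)
    have eq: "(\<integral>x. f x + g x \<partial>M) = (\<integral>x. f x \<partial>M) + (\<integral>x. g x \<partial>M)"
      if "prob_space M \<and> sets M = sets borel" for M
      using int[OF trig_poly_continuous that] trig_poly_add
      by (intro Bochner_Integration.integral_add) auto
    have "((\<lambda>T. (\<integral>x. f x \<partial>\<mu> T) + (\<integral>x. g x \<partial>\<mu> T)) \<longlongrightarrow> (\<integral>x. f x \<partial>\<pi>) + (\<integral>x. g x \<partial>\<pi>)) F"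
      by (intro tendsto_add trig_poly_add)
    moreover have "\<forall>\<^sub>F T in F. (\<integral>x. f x \<partial>\<mu> T) + (\<integral>x. g x \<partial>\<mu> T) = (\<integral>x. f x + g x \<partial>\<mu> T)"
      using \<mu> by eventually_elim (rule eq[symmetric])
    ultimately show ?case
      using eq[of \<pi>] \<pi> by (simp add: tendsto_cong)
  qed
  show ?thesis
    unfolding weakly_converges_def
  proof (intro allI impI tendstoI)
    fix f :: "'n torus \<Rightarrow> real" and e :: real assume f: "continuous_on UNIV f" and "e > 0"
    then obtain g where g: "trig_poly g" "\<forall>x. \<bar>f x - g x\<bar> < e / 3"
      using trig_poly_dense[OF f, of "e / 3"] by auto
    \<comment> \<open>Uniform approximation gives the same error for every probability measure, so
      it applies to all \<open>\<mu> T\<close> and to \<open>\<pi>\<close> alike.\<close>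
    have near: "\<bar>(\<integral>x. f x \<partial>M) - (\<integral>x. g x \<partial>M)\<bar> \<le> e / 3" if M: "prob_space M \<and> sets M = sets borel" for M
    proof -
      interpret prob_space M using M by simp
      note ifg = int[OF f M] int[OF trig_poly_continuous[OF g(1)] M]
      have "\<bar>(\<integral>x. f x \<partial>M) - (\<integral>x. g x \<partial>M)\<bar> = \<bar>\<integral>x. f x - g x \<partial>M\<bar>"
        using ifg by simp
      also have "\<dots> \<le> (\<integral>x. \<bar>f x - g x\<bar> \<partial>M)" by (rule integral_abs_bound)
      also have "\<dots> \<le> e / 3"
        by (rule integral_le_const) (use ifg g(2) in \<open>auto intro: less_imp_le\<close>)
      finally show ?thesis .
    qed
    have "\<forall>\<^sub>F T in F. dist (\<integral>x. g x \<partial>\<mu> T) (\<integral>x. g x \<partial>\<pi>) < e / 3"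
      using tendstoD[OF poly[OF g(1)], of "e / 3"] \<open>e > 0\<close> by simp
    then show "\<forall>\<^sub>F T in F. dist (\<integral>x. f x \<partial>\<mu> T) (\<integral>x. f x \<partial>\<pi>) < e"
      using \<mu>
    proof eventually_elim
      case (elim T)
      show ?case
        using near[OF elim(2)] near[of \<pi>] \<pi> elim(1) unfolding dist_real_def by linarith
    qed
  qed
qed

section \<open>Nets and quadrature\<close>

text \<open>Induction strips the lowest digit: if \<open>j\<close> has the digits from position 1
  on, then \<open>a 0 + n * j\<close> has all of them.\<close>

lemma ex_digits:
  fixes a :: "nat \<Rightarrow> nat"
  assumes "\<And>i. a i < n"
  shows "\<exists>j<n ^ k. \<forall>i<k. (j div n ^ i) mod n = a i"
  using assms
proof (induction k arbitrary: a)
  case (Suc k)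
  obtain j where j: "j < n ^ k" "\<forall>i<k. (j div n ^ i) mod n = a (Suc i)"
    using Suc.IH[of "\<lambda>i. a (Suc i)"] Suc.prems by auto
  have a0: "a 0 < n" by (rule Suc.prems)
  have "a 0 + n * j < n ^ Suc k"
  proof -
    have "a 0 + n * j < n + n * j" using a0 by simp
    also have "\<dots> = n * Suc j" by simp
    also have "\<dots> \<le> n * n ^ k" using j(1) by (intro mult_le_mono2) simp
    finally show ?thesis by simp
  qed
  moreover have "((a 0 + n * j) div n ^ i) mod n = a i" if "i < Suc k" for i
  proof (cases i)
    case 0
    then show ?thesis using a0 by simp
  next
    case (Suc l)
    have "(a 0 + n * j) div n ^ i = (a 0 + n * j) div n div n ^ l"
      by (simp add: Suc div_mult2_eq)
    also have "(a 0 + n * j) div n = j" using a0 by simp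
    finally show ?thesis using j(2) that Suc by simp
  qed
  ultimately show ?case by blast
qed simp

text \<open>Counting in base \<open>n\<close> without reducing the digits modulo \<open>n\<close>: the lift winds around the torus,
  so that a carry moves a coordinate by \<open>1 / n\<close> instead of back to 0.\<close>

definition grid_point :: "('n::finite \<Rightarrow> nat) \<Rightarrow> nat \<Rightarrow> nat \<Rightarrow> real ^ 'n" where
  "grid_point e n j = (\<chi> i. real (j div n ^ e i) / real n)"

text \<open>The l1 norm dominates the Euclidean norm. The dimension appears here instead of its
  square root, which changes only constants.\<close>

lemma norm_vec_le_CARD:
  fixes v :: "real ^ 'n::finite"
  assumes "\<And>i. \<bar>v $ i\<bar> \<le> c"
  shows "norm v \<le> real CARD('n) * c"
  using norm_le_l1_cart[of v] sum_bounded_above[of UNIV "\<lambda>i. \<bar>v $ i\<bar>" c] assms by simp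

lemma grid_point_step:
  fixes e :: "'n::finite \<Rightarrow> nat"
  assumes "n > 0"
  shows "norm (grid_point e n (Suc j) - grid_point e n j) \<le> real CARD('n) * (1 / real n)"
proof (rule norm_vec_le_CARD)
  fix i
  have "Suc j div n ^ e i = j div n ^ e i \<or> Suc j div n ^ e i = Suc (j div n ^ e i)"
    by (simp add: div_Suc)
  then have "\<bar>real (Suc j div n ^ e i) - real (j div n ^ e i)\<bar> \<le> 1" by auto
  then show "\<bar>(grid_point e n (Suc j) - grid_point e n j) $ i\<bar> \<le> 1 / real n"
    using assms by (simp add: grid_point_def diff_divide_distrib[symmetric] divide_right_mono)
qed

text \<open>Rounding the coordinates of a representative in the unit cube down to multiples of 1/n
  gives \<open>z\<close>, and the numerators are read as the base-\<open>n\<close> digits of an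
  index \<open>j\<close>. The winding point \<open>grid_point e n j\<close> differs from
  \<open>z\<close> by integers.\<close>

lemma grid_point_net:
  fixes e :: "'n::finite \<Rightarrow> nat"
  assumes e: "bij_betw e UNIV {..<CARD('n)}" and "n > 0"
  shows "\<exists>j<n ^ CARD('n). dist x (torus_proj (grid_point e n j)) \<le> real CARD('n) * (1 / real n)"
proof -
  obtain b where b: "b \<in> unit_cube" "torus_proj b = x" by (rule ex_unit_cube_rep)
  define a where "a i = nat \<lfloor>real n * b $ inv e i\<rfloor>" for i
  have b01: "0 \<le> b $ i" "b $ i < 1" for i using b by (auto simp: unit_cube_def)
  have "a i < n" for i
  proof -
    have "real n * b $ inv e i < real n" using b01(2)[of "inv e i"] \<open>n > 0\<close> by simp
    then show ?thesis unfolding a_def using b01(1)[of "inv e i"] \<open>n > 0\<close>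
      by (simp add: nat_less_iff floor_less_iff)
  qed
  then obtain j where j: "j < n ^ CARD('n)" "\<forall>i<CARD('n). (j div n ^ i) mod n = a i"
    using ex_digits[of a n] by blast
  define z :: "real ^ 'n" where "z = (\<chi> i. real (a (e i)) / real n)"
  have "torus_proj (grid_point e n j) = torus_proj z"
    unfolding torus_proj_eq_iff torus_eq_def
  proof
    fix i
    have "e i < CARD('n)" using e by (auto simp: bij_betw_def)
    then have "j div n ^ e i = n * (j div n ^ e i div n) + a (e i)"
      using j(2) by (metis mult_div_mod_eq)
    then have "real (j div n ^ e i) = real n * real (j div n ^ e i div n) + real (a (e i))"
      by (metis of_nat_add of_nat_mult)
    then have "grid_point e n j $ i - z $ i = real (j div n ^ e i div n)"
      using \<open>n > 0\<close> by (simp add: grid_point_def z_def field_simps)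
    then show "grid_point e n j $ i - z $ i \<in> \<int>" by (metis Ints_of_nat)
  qed
  then have "dist x (torus_proj (grid_point e n j)) \<le> dist b z"
    using dist_torus_proj_le[of b z] b(2) by simp
  also have "\<dots> \<le> real CARD('n) * (1 / real n)"
    unfolding dist_norm
  proof (rule norm_vec_le_CARD)
    fix i
    have "inv e (e i) = i" using e by (simp add: bij_betw_def)
    then have "real (a (e i)) \<le> real n * b $ i" "real n * b $ i < real (a (e i)) + 1"
      using b01(1)[of i] by (auto simp: a_def)
    then have "\<bar>real n * b $ i - real (a (e i))\<bar> \<le> 1" by linarith
    moreover have "(b - z) $ i = (real n * b $ i - real (a (e i))) / real n"
      using \<open>n > 0\<close> by (simp add: z_def diff_divide_distrib)
    ultimately show "\<bar>(b - z) $ i\<bar> \<le> 1 / real n"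
      by (simp add: divide_right_mono)
  qed
  finally show ?thesis using j(1) by blast
qed

text \<open>Each \<open>x\<close> is sent to the first net point within \<delta>, of index
  \<open>J x\<close>. The cells \<open>B j\<close> of this assignment partition the torus and their
  masses are the weights, so the weighted sum is the integral of \<open>f (y (J x))\<close>. The
  weights precede \<open>f\<close> in the quantifiers.\<close>

lemma ex_quadrature_weights:
  fixes \<pi> :: "('n::finite) torus measure" and y :: "nat \<Rightarrow> 'n torus"
  assumes \<pi>: "prob_space \<pi>" "sets \<pi> = sets borel"
    and net: "\<And>x. \<exists>j<N. dist x (y j) \<le> \<delta>"
  shows "\<exists>w. (\<forall>j. 0 \<le> w j) \<and> (\<Sum>j<N. w j) = 1 \<and>
    (\<forall>f L. L-lipschitz_on UNIV f \<longrightarrow> \<bar>(\<Sum>j<N. w j * f (y j)) - (\<integral>x. f x \<partial>\<pi>)\<bar> \<le> L * \<delta>)"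
proof -
  interpret prob_space \<pi> by fact
  define B where "B j = {x. dist x (y j) \<le> \<delta> \<and> (\<forall>i<j. \<not> dist x (y i) \<le> \<delta>)}" for j
  define J where "J x = (LEAST j. dist x (y j) \<le> \<delta>)" for x
  have J: "dist x (y (J x)) \<le> \<delta>" "J x < N" for x
  proof -
    obtain j where j: "j < N" "dist x (y j) \<le> \<delta>" using net by blast
    then show "dist x (y (J x)) \<le> \<delta>" "J x < N"
      unfolding J_def by (metis (mono_tags) LeastI, metis (mono_tags) Least_le le_less_trans)
  qed
  have B_iff: "x \<in> B j \<longleftrightarrow> j = J x" for x j
  proof
    assume "x \<in> B j"
    then have l: "dist x (y j) \<le> \<delta>" "\<And>i. dist x (y i) \<le> \<delta> \<Longrightarrow> j \<le> i"
      unfolding B_def using not_le_imp_less by blast+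
    have "(LEAST j. dist x (y j) \<le> \<delta>) = j"
      by (rule Least_equality[where P = "\<lambda>j. dist x (y j) \<le> \<delta>", OF l])
    then show "j = J x" unfolding J_def by (rule sym)
  next
    assume j: "j = J x"
    have "\<not> dist x (y i) \<le> \<delta>" if "i < J x" for i
      using that unfolding J_def by (rule not_less_Least[where P = "\<lambda>j. dist x (y j) \<le> \<delta>"])
    then show "x \<in> B j"
      using J(1)[of x] unfolding B_def j by blast
  qed
  have "B j \<in> sets borel" for j
    unfolding B_def by measurable
  then have B [measurable]: "B j \<in> sets \<pi>" for j
    using \<pi>(2) by simp
  have sum_B: "(\<Sum>j<N. indicator (B j) x * c j) = c (J x)" for x and c :: "nat \<Rightarrow> real"
  proof -
    have "(\<Sum>j<N. indicator (B j) x * c j) = (\<Sum>j<N. if j = J x then c j else 0)"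
      by (intro sum.cong) (auto simp: indicator_def B_iff)
    then show ?thesis using J(2)[of x] by simp
  qed
  have int_B: "integrable \<pi> (\<lambda>x. indicator (B j) x * c)" for j and c :: real
    by (intro integrable_mult_left integrable_real_indicator B) (simp add: emeasure_eq_measure)
  have sum_w: "(\<Sum>j<N. measure \<pi> (B j) * c j) = (\<integral>x. c (J x) \<partial>\<pi>)"
    and int_J: "integrable \<pi> (\<lambda>x. c (J x))" for c
  proof -
    show "integrable \<pi> (\<lambda>x. c (J x))"
      unfolding sum_B[symmetric] by (intro Bochner_Integration.integrable_sum int_B)
    show "(\<Sum>j<N. measure \<pi> (B j) * c j) = (\<integral>x. c (J x) \<partial>\<pi>)"
      unfolding sum_B[symmetric] using int_B
      by (subst Bochner_Integration.integral_sum) simp_all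
  qed
  show ?thesis
  proof (intro exI[of _ "\<lambda>j. measure \<pi> (B j)"] conjI allI impI)
    show "(\<Sum>j<N. measure \<pi> (B j)) = 1"
      using sum_w[of "\<lambda>_. 1"] by (simp add: prob_space)
  next
    fix f :: "'n torus \<Rightarrow> real" and L assume f: "L-lipschitz_on UNIV f"
    have intf: "integrable \<pi> f"
      by (rule integrable_torus_continuous[OF lipschitz_on_continuous_on[OF f] finite_measure_axioms \<pi>(2)])
    have "(\<Sum>j<N. measure \<pi> (B j) * f (y j)) - (\<integral>x. f x \<partial>\<pi>) = (\<integral>x. f (y (J x)) - f x \<partial>\<pi>)"
      using sum_w[of "\<lambda>j. f (y j)"] int_J[of "\<lambda>j. f (y j)"] intf by simp
    also have "\<bar>\<dots>\<bar> \<le> (\<integral>x. \<bar>f (y (J x)) - f x\<bar> \<partial>\<pi>)"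
      by (rule integral_abs_bound)
    also have "\<dots> \<le> L * \<delta>"
    proof (rule integral_le_const)
      show "integrable \<pi> (\<lambda>x. \<bar>f (y (J x)) - f x\<bar>)"
        using int_J[of "\<lambda>j. f (y j)"] intf by simp
      have "\<bar>f (y (J x)) - f x\<bar> \<le> L * \<delta>" for x
        using lipschitz_onD[OF f, of "y (J x)" x] mult_left_mono[OF J(1)[of x] lipschitz_on_nonneg[OF f]]
        by (simp add: dist_real_def dist_commute)
      then show "AE x in \<pi>. \<bar>f (y (J x)) - f x\<bar> \<le> L * \<delta>" by simp
    qed
    finally show "\<bar>(\<Sum>j<N. measure \<pi> (B j) * f (y j)) - (\<integral>x. f x \<partial>\<pi>)\<bar> \<le> L * \<delta>" .
  qed simp
qed

section \<open>Time averages along a curve\<close>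

lemma emeasure_lebesgue_on_interval: "T \<ge> 0 \<Longrightarrow> emeasure (lebesgue_on {0..T}) {0..T} = ennreal T"
  by (simp add: emeasure_restrict_space)

lemma prob_space_gamma: "T > 0 \<Longrightarrow> prob_space (gamma T)"
  unfolding gamma_def
  by (rule prob_space_uniform_measure) (simp_all add: emeasure_lebesgue_on_interval)

lemma sets_gamma [measurable_cong]: "sets (gamma T) = sets (lebesgue_on {0..T})"
  by (simp add: gamma_def)

lemma space_gamma: "space (gamma T) = {0..T}"
  by (simp add: gamma_def)

lemma integral_gamma:
  fixes f :: "real \<Rightarrow> real"
  assumes "continuous_on {0..T} f" "T > 0"
  shows "(\<integral>t. f t \<partial>gamma T) = integral {0..T} f / T"
proof -
  have [measurable]: "f \<in> borel_measurable (lebesgue_on {0..T})"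
    using borel_measurable_integrable[OF integrable_lebesgue_on_continuous[OF assms(1)]] .
  have "{0..T} \<in> sets (lebesgue_on {0..T})"
    using sets.top[of "lebesgue_on {0..T}"] by simp
  then have [measurable]: "(\<lambda>x. indicator {0..T} x / ennreal T) \<in> borel_measurable (lebesgue_on {0..T})"
    by measurable
  have "gamma T = density (lebesgue_on {0..T}) (\<lambda>x. ennreal (1 / T))"
    unfolding gamma_def uniform_measure_def emeasure_lebesgue_on_interval[OF less_imp_le[OF assms(2)]]
  proof (intro density_cong AE_I2)
    fix x assume "x \<in> space (lebesgue_on {0..T})"
    then show "indicator {0..T} x / ennreal T = ennreal (1 / T)"
      using divide_ennreal[of 1 T] assms(2) by simp
  qed simp_all
  then have "(\<integral>t. f t \<partial>gamma T) = (\<integral>t. (1 / T) *\<^sub>R f t \<partial>lebesgue_on {0..T})"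
    using assms(2) by (simp add: integral_density)
  then show ?thesis
    by (simp add: integral_lebesgue_on_continuous[OF assms(1)])
qed

lemma curves_measurable:
  assumes "p \<in> curves m \<alpha> T"
  shows "p \<in> measurable (gamma T) borel"
proof -
  obtain q where q: "continuous_on {0..T} q" "\<And>t. t \<in> {0..T} \<Longrightarrow> p t = torus_proj (q t)"
    using assms by (auto simp: curves_def)
  have "q \<in> borel_measurable (lebesgue_on {0..T})"
    using borel_measurable_integrable[OF integrable_lebesgue_on_continuous[OF q(1)]] .
  then have "(\<lambda>t. torus_proj (q t)) \<in> measurable (gamma T) borel"
    by measurable
  then show ?thesis
    by (rule measurable_cong[THEN iffD1, rotated]) (simp add: q(2) space_gamma)
qed

lemma prob_space_curve_measures:
  assumes "\<mu> \<in> curve_measures m \<alpha> T" "T > 0"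
  shows "prob_space \<mu>" "sets \<mu> = sets borel"
  using assms by (auto simp: curve_measures_def intro!: prob_space.prob_space_distr prob_space_gamma curves_measurable)

text \<open>The error on each piece is at most \<epsilon> times its length. It will be applied with
  one piece for the rest at a grid point together with the move that follows.\<close>

lemma integral_piecewise_near_const:
  fixes g :: "real \<Rightarrow> real"
  assumes g: "continuous_on UNIV g" and "u 0 = 0" and u: "\<And>j. u j \<le> u (Suc j)"
    and near: "\<And>j t. j < N \<Longrightarrow> u j \<le> t \<Longrightarrow> t \<le> u (Suc j) \<Longrightarrow> \<bar>g t - c j\<bar> \<le> \<epsilon>"
  shows "\<bar>integral {0..u N} g - (\<Sum>j<N. (u (Suc j) - u j) * c j)\<bar> \<le> \<epsilon> * u N"
  using near
proof (induction N)
  case 0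
  then show ?case by (simp add: \<open>u 0 = 0\<close>)
next
  case (Suc N)
  have ig: "g integrable_on {a..b}" for a b
    by (rule integrable_continuous_interval[OF continuous_on_subset[OF g subset_UNIV]])
  have u0: "0 \<le> u j" for j
    using lift_Suc_mono_le[of u 0 j] u \<open>u 0 = 0\<close> by simp
  have "integral {u N..u (Suc N)} (\<lambda>t. g t - c N) = integral {u N..u (Suc N)} g - (u (Suc N) - u N) * c N"
    using u[of N] by (subst integral_diff) (simp_all add: ig integrable_const_ivl)
  moreover have "norm (integral {u N..u (Suc N)} (\<lambda>t. g t - c N)) \<le> \<epsilon> * (u (Suc N) - u N)"
  proof (rule integral_bound[OF u])
    show "continuous_on {u N..u (Suc N)} (\<lambda>t. g t - c N)"
      by (intro continuous_on_diff continuous_on_const continuous_on_subset[OF g subset_UNIV])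
    show "\<And>t. t \<in> {u N..u (Suc N)} \<Longrightarrow> norm (g t - c N) \<le> \<epsilon>"
      using Suc.prems[of N] by simp
  qed
  ultimately have last: "\<bar>integral {u N..u (Suc N)} g - (u (Suc N) - u N) * c N\<bar> \<le> \<epsilon> * (u (Suc N) - u N)"
    by simp
  have "integral {0..u (Suc N)} g = integral {0..u N} g + integral {u N..u (Suc N)} g"
    by (rule Henstock_Kurzweil_Integration.integral_combine[OF u0 u ig, symmetric])
  moreover have "\<bar>integral {0..u N} g - (\<Sum>j<N. (u (Suc j) - u j) * c j)\<bar> \<le> \<epsilon> * u N"
    by (rule Suc.IH) (use Suc.prems in simp)
  ultimately show ?case
    using last unfolding sum.lessThan_Suc right_diff_distrib by linarith
qed

text \<open>The torus has total mass 1, so a uniform bound is also a bound in L2.\<close>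

lemma N_diff_le:
  fixes h :: "('n::finite) torus \<Rightarrow> real"
  assumes h: "L-lipschitz_on UNIV h"
    and \<mu>: "prob_space \<mu>" "sets \<mu> = sets borel" and \<nu>: "prob_space \<nu>" "sets \<nu> = sets borel"
    and le: "\<And>x. \<bar>conv_measure h \<mu> x - conv_measure h \<nu> x\<bar> \<le> C"
  shows "N_diff h \<mu> \<nu> \<le> C"
proof -
  interpret prob_space "torus_lebesgue :: 'n torus measure" by (rule prob_space_torus_lebesgue)
  have C: "0 \<le> C" using le[of 0] by linarith
  have "continuous_on UNIV (\<lambda>x. (conv_measure h \<mu> x - conv_measure h \<nu> x)\<^sup>2)"
    by (intro continuous_on_power continuous_on_diff
        lipschitz_on_continuous_on[OF lipschitz_conv_measure[OF h \<mu>]]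
        lipschitz_on_continuous_on[OF lipschitz_conv_measure[OF h \<nu>]])
  then have "integrable torus_lebesgue (\<lambda>x. (conv_measure h \<mu> x - conv_measure h \<nu> x)\<^sup>2)"
    using finite_measure_axioms by (rule integrable_torus_continuous) simp
  then have "(\<integral>x. (conv_measure h \<mu> x - conv_measure h \<nu> x)\<^sup>2 \<partial>torus_lebesgue) \<le> C\<^sup>2"
    using le C by (intro integral_le_const AE_I2) (simp_all add: abs_le_square_iff[symmetric])
  then show ?thesis
    unfolding N_diff_def using C by (simp add: real_le_lsqrt)
qed

section \<open>Curves resting at the points of a grid\<close>

text \<open>The first error term is the distance from \<open>x j\<close> during stage
  \<open>j\<close>. The second is the discrepancy between \<open>w j\<close> and the share of time
  that stage \<open>j\<close> really takes, since only \<open>W = T - N * \<tau>\<close> is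
  distributed according to \<open>w\<close>. The last hypothesis keeps the derivatives of the scaled
  steps below \<open>\<alpha> i\<close>.\<close>

lemma ex_curve_near_quadrature:
  fixes x :: "nat \<Rightarrow> real ^ 'n::finite"
  assumes \<psi>: "step_chain m \<psi>" and K: "\<And>i t. i \<le> m \<Longrightarrow> \<bar>\<psi> i t\<bar> \<le> K"
    and r: "\<And>j. norm (x (Suc j) - x j) \<le> r"
    and w: "\<And>j. 0 \<le> w j" "(\<Sum>j<N. w j) = 1"
    and \<tau>: "\<tau> > 0" "real N * \<tau> \<le> T" and T: "T > 0"
    and \<alpha>: "\<And>i. i \<in> {1..m} \<Longrightarrow> K * r \<le> \<tau> ^ i * \<alpha> i"
  shows "\<exists>\<nu>\<in>curve_measures m \<alpha> T. \<forall>f L M. L-lipschitz_on UNIV f \<longrightarrow> (\<forall>y. \<bar>f y\<bar> \<le> M) \<longrightarrow>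
    \<bar>(\<integral>y. f y \<partial>\<nu>) - (\<Sum>j<N. w j * f (torus_proj (x j)))\<bar> \<le> L * (K * r) + 2 * M * (real N * \<tau> / T)"
proof -
  \<comment> \<open>The curve rests at \<open>x j\<close> during \<open>[u j, s j]\<close> and moves to \<open>x (Suc j)\<close> during
    \<open>[s j, s j + \<tau>] = [s j, u (Suc j)]\<close>.\<close>
  define W where "W = T - real N * \<tau>"
  define u where "u j = real j * \<tau> + W * (\<Sum>i<j. w i)" for j
  define s where "s j = u j + W * w j" for j
  define \<Delta> where "\<Delta> j = x (Suc j) - x j" for j
  \<comment> \<open>Step \<open>j\<close> is delayed by \<open>s j\<close> and stretched by \<tau>,
    so the chain rule divides its \<open>i\<close>-th derivative by \<open>\<tau> ^ i\<close>; the
    starting point \<open>x 0\<close> survives only in order 0.\<close>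
  define D where "D i t = (if i = 0 then x 0 else 0) + (\<Sum>j<N. (\<psi> i ((t - s j) / \<tau>) / \<tau> ^ i) *\<^sub>R \<Delta> j)" for i t
  have W: "0 \<le> W" using \<tau>(2) by (simp add: W_def)
  have K0: "0 \<le> K" using K[of 0 0] by linarith
  have Kr: "\<bar>c\<bar> * norm (\<Delta> j) \<le> K * r" if "\<bar>c\<bar> \<le> K" for c j
    unfolding \<Delta>_def using that r K0 by (intro mult_mono) auto
  have u0: "u 0 = 0" by (simp add: u_def)
  have uN: "u N = T" by (simp add: u_def w(2) W_def)
  have us: "u j \<le> s j" for j using W w(1) by (simp add: s_def)
  have su: "u (Suc j) = s j + \<tau>" for j by (simp add: s_def u_def algebra_simps)
  have u_mono: "u i \<le> u j" if "i \<le> j" for i j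
    by (rule lift_Suc_mono_le[OF _ that]) (use su us \<tau>(1) in \<open>smt (verit)\<close>)
  have psi0: "\<psi> 0 t = 0" if "t \<le> 0" for t using \<psi> that by (simp add: step_chain_def)
  have psi1: "\<psi> 0 t = 1" if "t \<ge> 1" for t using \<psi> that by (simp add: step_chain_def)
  have psii: "\<psi> i t = 0" if "i \<in> {1..m}" "t \<le> 0 \<or> t \<ge> 1" for i t
    using \<psi> that unfolding step_chain_def by auto
  have ge1: "1 \<le> (t - s l) / \<tau>" if "l < j" "u j \<le> t" for l j t
  proof -
    have "s l + \<tau> \<le> u j" using u_mono[of "Suc l" j] that(1) su[of l] by simp
    then show ?thesis using \<tau>(1) that(2) by (simp add: pos_le_divide_eq)
  qed
  have le0: "(t - s l) / \<tau> \<le> 0" if "j < l" "t \<le> u (Suc j)" for l j t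
  proof -
    have "t \<le> s l" using u_mono[of "Suc j" l] us[of l] that by simp
    then show ?thesis using \<tau>(1) by (simp add: divide_le_0_iff)
  qed

  have chain: "deriv_chain m D"
    unfolding deriv_chain_def
  proof (intro conjI allI impI)
    fix i t assume "i < m"
    have "((\<lambda>t. \<psi> i ((t - s j) / \<tau>) / \<tau> ^ i) has_real_derivative \<psi> (Suc i) ((t - s j) / \<tau>) / \<tau> ^ Suc i) (at t)" for j
    proof -
      have d: "(\<psi> i has_real_derivative \<psi> (Suc i) z) (at z)" for z
        using \<psi> \<open>i < m\<close> by (simp add: step_chain_def deriv_chain_def has_real_derivative_iff_has_vector_derivative)
      have "((\<lambda>t. (t - s j) / \<tau>) has_real_derivative 1 / \<tau>) (at t)"
        by (intro DERIV_cdivide) (auto intro!: derivative_eq_intros)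
      from DERIV_cdivide[OF DERIV_chain2[OF d this], of "\<tau> ^ i"] show ?thesis
        by (simp add: field_simps)
    qed
    then have "((\<lambda>t. (\<psi> i ((t - s j) / \<tau>) / \<tau> ^ i) *\<^sub>R \<Delta> j) has_vector_derivative
        (\<psi> (Suc i) ((t - s j) / \<tau>) / \<tau> ^ Suc i) *\<^sub>R \<Delta> j) (at t)" for j
      using has_vector_derivative_scaleR[OF _ has_vector_derivative_const[of "\<Delta> j"]] by fastforce
    then have "((\<lambda>t. (if i = 0 then x 0 else 0) + (\<Sum>j<N. (\<psi> i ((t - s j) / \<tau>) / \<tau> ^ i) *\<^sub>R \<Delta> j))
        has_vector_derivative 0 + (\<Sum>j<N. (\<psi> (Suc i) ((t - s j) / \<tau>) / \<tau> ^ Suc i) *\<^sub>R \<Delta> j)) (at t)"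
      by (intro has_vector_derivative_add has_vector_derivative_const has_vector_derivative_sum)
    then show "(D i has_vector_derivative D (Suc i) t) (at t)"
      by (simp add: D_def[abs_def])
  next
    have "continuous_on UNIV (\<psi> m)"
      using \<psi> by (simp add: step_chain_def deriv_chain_def)
    moreover have "continuous_on UNIV (\<lambda>t. (t - s j) / \<tau>)" for j
      using \<tau>(1) by (auto intro!: continuous_intros)
    ultimately have "continuous_on UNIV (\<lambda>t. \<psi> m ((t - s j) / \<tau>))" for j
      by (rule continuous_on_compose2) simp
    then show "continuous_on UNIV (D m)"
      unfolding D_def[abs_def] using \<tau>(1)
      by (intro continuous_on_add continuous_on_const continuous_on_sum continuous_on_scaleR continuous_on_divide) simp_all
  qed

  have bound: "norm (D i t) \<le> \<alpha> i" if i: "i \<in> {1..m}" for i t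
  proof -
    \<comment> \<open>The windows of the moves are disjoint, so at most one summand of
      \<open>D i t\<close> is nonzero and the bound does not grow with \<open>N\<close>.\<close>
    have one: "\<exists>j0. \<forall>j. j \<noteq> j0 \<longrightarrow> \<psi> i ((t - s j) / \<tau>) = 0"
    proof (cases "\<exists>j0. \<psi> i ((t - s j0) / \<tau>) \<noteq> 0")
      case True
      then obtain j0 where "\<psi> i ((t - s j0) / \<tau>) \<noteq> 0" ..
      then have "0 < (t - s j0) / \<tau>" "(t - s j0) / \<tau> < 1"
        using psii[OF i, of "(t - s j0) / \<tau>"] by linarith+
      then have t: "s j0 < t" "t < s j0 + \<tau>"
        using \<tau>(1) by (simp_all add: zero_less_divide_iff pos_divide_less_eq)
      have "\<psi> i ((t - s j) / \<tau>) = 0" if "j \<noteq> j0" for j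
      proof (rule psii[OF i], cases "j < j0")
        case True
        then show "(t - s j) / \<tau> \<le> 0 \<or> 1 \<le> (t - s j) / \<tau>"
          using ge1[of j j0 t] us[of j0] t(1) by simp
      next
        case False
        then show "(t - s j) / \<tau> \<le> 0 \<or> 1 \<le> (t - s j) / \<tau>"
          using le0[of j0 j t] that t(2) su[of j0] by simp
      qed
      then show ?thesis by blast
    qed blast
    then obtain j0 where j0: "\<And>j. j \<noteq> j0 \<Longrightarrow> \<psi> i ((t - s j) / \<tau>) = 0" by blast
    have "D i t = (\<Sum>j<N. (\<psi> i ((t - s j) / \<tau>) / \<tau> ^ i) *\<^sub>R \<Delta> j)"
      using i by (simp add: D_def)
    also have "\<dots> = (\<Sum>j<N. if j = j0 then (\<psi> i ((t - s j0) / \<tau>) / \<tau> ^ i) *\<^sub>R \<Delta> j0 else 0)"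
      by (rule sum.cong[OF refl]) (simp add: j0)
    finally have "norm (D i t) \<le> norm ((\<psi> i ((t - s j0) / \<tau>) / \<tau> ^ i) *\<^sub>R \<Delta> j0)"
      by simp
    also have "\<dots> = \<bar>\<psi> i ((t - s j0) / \<tau>)\<bar> * norm (\<Delta> j0) / \<tau> ^ i"
      using \<tau>(1) by simp
    also have "\<dots> \<le> K * r / \<tau> ^ i"
      using \<tau>(1) i by (intro divide_right_mono Kr K) auto
    also have "\<dots> \<le> \<alpha> i"
      using \<alpha>[OF i] \<tau>(1) by (simp add: pos_divide_le_eq mult.commute)
    finally show ?thesis .
  qed

  have pos: "norm (D 0 t - x j) \<le> K * r" if "j < N" and t: "u j \<le> t" "t \<le> u (Suc j)" for j t
  proof -
    \<comment> \<open>During stage \<open>j\<close> the earlier steps are complete and the later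
      ones have not begun; the completed displacements telescope to
      \<open>x j - x 0\<close>.\<close>
    have "(\<Sum>l<N. \<psi> 0 ((t - s l) / \<tau>) *\<^sub>R \<Delta> l) = (\<Sum>l<Suc j. \<psi> 0 ((t - s l) / \<tau>) *\<^sub>R \<Delta> l)"
      using \<open>j < N\<close> le0[OF _ t(2)] by (intro sum.mono_neutral_right) (auto simp: psi0)
    also have "\<dots> = (\<Sum>l<j. \<Delta> l) + \<psi> 0 ((t - s j) / \<tau>) *\<^sub>R \<Delta> j"
      using ge1[OF _ t(1)] by (simp add: psi1)
    also have "(\<Sum>l<j. \<Delta> l) = x j - x 0"
      unfolding \<Delta>_def by (rule sum_lessThan_telescope)
    finally have "D 0 t - x j = \<psi> 0 ((t - s j) / \<tau>) *\<^sub>R \<Delta> j"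
      by (simp add: D_def)
    then show ?thesis by (simp add: Kr K)
  qed

  let ?p = "\<lambda>t. torus_proj (D 0 t)"
  have p: "?p \<in> curves m \<alpha> T"
    using T by (intro deriv_chain_in_curves chain bound) simp
  show ?thesis
  proof (rule bexI[of _ "distr (gamma T) borel ?p"], intro allI impI)
    fix f :: "'n torus \<Rightarrow> real" and L M :: real
    assume f: "L-lipschitz_on UNIV f" and M: "\<forall>y. \<bar>f y\<bar> \<le> M"
    define c where "c j = f (torus_proj (x j))" for j
    have cont: "continuous_on S (\<lambda>t. f (?p t))" for S
      by (rule continuous_on_compose2[OF lipschitz_on_continuous_on[OF f]
            continuous_on_compose2[OF continuous_on_torus_proj deriv_chain_continuous_on[OF chain]]]) auto
    have int: "(\<integral>y. f y \<partial>distr (gamma T) borel ?p) = integral {0..T} (\<lambda>t. f (?p t)) / T"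
      by (subst integral_distr[OF curves_measurable[OF p]])
        (simp_all add: integral_gamma[OF cont T] borel_measurable_continuous_onI[OF lipschitz_on_continuous_on[OF f]])
    have "\<bar>integral {0..u N} (\<lambda>t. f (?p t)) - (\<Sum>j<N. (u (Suc j) - u j) * c j)\<bar> \<le> L * (K * r) * u N"
    proof (rule integral_piecewise_near_const[where u = u, OF cont u0])
      show "u j \<le> u (Suc j)" for j by (rule u_mono) simp
      fix j t assume "j < N" "u j \<le> t" "t \<le> u (Suc j)"
      then have "dist (?p t) (torus_proj (x j)) \<le> K * r"
        using dist_torus_proj_le[of "D 0 t" "x j"] pos[of j t] by (simp add: dist_norm)
      then show "\<bar>f (?p t) - c j\<bar> \<le> L * (K * r)"
        using lipschitz_onD[OF f, of "?p t" "torus_proj (x j)"]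
          mult_left_mono[OF _ lipschitz_on_nonneg[OF f]]
        unfolding c_def dist_real_def by (meson UNIV_I order_trans)
    qed
    then have "\<bar>(integral {0..T} (\<lambda>t. f (?p t)) - (\<Sum>j<N. (u (Suc j) - u j) * c j)) / T\<bar> \<le> L * (K * r)"
      using T by (simp add: uN abs_divide pos_divide_le_eq)
    moreover have "(\<Sum>j<N. (u (Suc j) - u j) / T * c j) = (\<Sum>j<N. (u (Suc j) - u j) * c j) / T"
      by (simp add: sum_divide_distrib)
    ultimately have 1: "\<bar>(\<integral>y. f y \<partial>distr (gamma T) borel ?p) - (\<Sum>j<N. (u (Suc j) - u j) / T * c j)\<bar> \<le> L * (K * r)"
      by (simp only: int diff_divide_distrib)
    \<comment> \<open>Stage \<open>j\<close> lasts \<open>\<tau> + W * w j\<close>, so its share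
      differs from \<open>w j\<close> by \<open>(\<tau> - N * \<tau> * w j) / T\<close>. Each of the
      two terms sums to \<open>N * \<tau> / T\<close>, hence the factor 2.\<close>
    have "\<bar>(\<Sum>j<N. (u (Suc j) - u j) / T * c j) - (\<Sum>j<N. w j * c j)\<bar>
        = \<bar>\<Sum>j<N. (\<tau> - real N * \<tau> * w j) / T * c j\<bar>"
    proof -
      have "(u (Suc j) - u j) / T - w j = (\<tau> - real N * \<tau> * w j) / T" for j
        using T by (simp add: su s_def W_def field_simps)
      then show ?thesis
        by (simp only: sum_subtractf[symmetric] left_diff_distrib[symmetric])
    qed
    also have "\<dots> \<le> (\<Sum>j<N. (\<tau> + real N * \<tau> * w j) / T * M)"
    proof (rule order_trans[OF sum_abs sum_mono])
      fix j
      have nonneg: "0 \<le> real N * \<tau> * w j" using \<tau>(1) w(1)[of j] by simp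
      then have "\<bar>\<tau> - real N * \<tau> * w j\<bar> \<le> \<tau> + real N * \<tau> * w j"
        unfolding abs_le_iff using \<tau>(1) by linarith
      then have "\<bar>(\<tau> - real N * \<tau> * w j) / T\<bar> \<le> (\<tau> + real N * \<tau> * w j) / T"
        using T by (simp add: abs_divide divide_right_mono)
      then show "\<bar>(\<tau> - real N * \<tau> * w j) / T * c j\<bar> \<le> (\<tau> + real N * \<tau> * w j) / T * M"
        unfolding abs_mult using M T \<tau>(1) nonneg by (intro mult_mono) (auto simp: c_def)
    qed
    also have "\<dots> = (\<Sum>j<N. \<tau> + real N * \<tau> * w j) / T * M"
      by (simp only: sum_divide_distrib sum_distrib_right)
    also have "(\<Sum>j<N. \<tau> + real N * \<tau> * w j) = 2 * (real N * \<tau>)"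
      by (simp add: sum.distrib sum_distrib_left[symmetric] w(2))
    finally have "\<bar>(\<Sum>j<N. (u (Suc j) - u j) / T * c j) - (\<Sum>j<N. w j * c j)\<bar> \<le> 2 * M * (real N * \<tau> / T)"
      by (simp add: mult_ac)
    with 1 show "\<bar>(\<integral>y. f y \<partial>distr (gamma T) borel ?p) - (\<Sum>j<N. w j * f (torus_proj (x j)))\<bar>
        \<le> L * (K * r) + 2 * M * (real N * \<tau> / T)"
      unfolding c_def by linarith
  qed (use p in \<open>simp add: curve_measures_def\<close>)
qed

text \<open>The condition relating \<open>n\<close> and \<open>T\<close> says that the total travel
  time fits into \<open>T\<close>. The constants \<open>A\<close>, \<open>C1\<close>,
  \<open>C2\<close> depend on neither, which leaves \<open>n\<close> free to be optimized.\<close>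

lemma ex_curve_measure_N_diff_le:
  fixes \<pi> :: "('n::finite) torus measure" and h :: "'n torus \<Rightarrow> real"
  assumes \<pi>: "prob_space \<pi>" "sets \<pi> = sets borel" and m: "m \<ge> 1"
    and \<alpha>: "\<And>i. i \<in> {1..m} \<Longrightarrow> \<alpha> i > 0" and h: "L-lipschitz_on UNIV h"
  shows "\<exists>A C1 C2. A \<ge> 0 \<and> C1 \<ge> 0 \<and> C2 \<ge> 0 \<and> (\<forall>n T. n \<ge> 1 \<longrightarrow> T > 0 \<longrightarrow>
    A * real n powr (real CARD('n) - 1 / real m) \<le> T \<longrightarrow>
    (\<exists>\<nu>\<in>curve_measures m \<alpha> T.
      N_diff h \<nu> \<pi> \<le> C1 / real n + C2 * (real n powr (real CARD('n) - 1 / real m) / T)))"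
proof -
  obtain \<psi> where \<psi>: "step_chain m \<psi>" using ex_step_chain by blast
  obtain K where K: "K \<ge> 1" "\<And>i t. i \<le> m \<Longrightarrow> \<bar>\<psi> i t\<bar> \<le> K" using step_chain_bounded[OF \<psi>] by blast
  obtain M where M: "\<forall>x. \<bar>h x\<bar> \<le> M"
    using bounded_torus_continuous[OF lipschitz_on_continuous_on[OF h]] by auto
  have L: "L \<ge> 0" by (rule lipschitz_on_nonneg[OF h])
  have M0: "M \<ge> 0" using M[rule_format, of 0] by linarith
  obtain e :: "'n \<Rightarrow> nat" where e: "bij_betw e UNIV {..<CARD('n)}"
    using ex_bij_betw_finite_nat[of "UNIV :: 'n set"] by (auto simp: atLeast0LessThan)
  define d where "d = real CARD('n)"
  have d0: "d \<ge> 0" by (simp add: d_def)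
  \<comment> \<open>The sum makes \<open>A\<close> dominate every \<open>K * d / \<alpha> i\<close>,
    and the summand 1 gives \<open>A \<ge> 1\<close>, so that \<open>A \<le> A ^ i\<close>.\<close>
  define A where "A = 1 + (\<Sum>i\<in>{1..m}. K * d / \<alpha> i)"
  have nonneg: "0 \<le> K * d / \<alpha> i" if "i \<in> {1..m}" for i
    using K(1) d0 \<alpha>[OF that] by simp
  have A: "A \<ge> 1" unfolding A_def using sum_nonneg[of "{1..m}" "\<lambda>i. K * d / \<alpha> i"] nonneg by simp
  have A\<alpha>: "K * d \<le> A * \<alpha> i" if i: "i \<in> {1..m}" for i
  proof -
    have "K * d / \<alpha> i \<le> A"
      unfolding A_def using member_le_sum[of i "{1..m}" "\<lambda>i. K * d / \<alpha> i"] i nonneg by fastforce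
    then show ?thesis using \<alpha>[OF i] by (simp add: pos_divide_le_eq)
  qed
  show ?thesis
  proof (rule exI[of _ A], rule exI[of _ "L * (K + 1) * d"], rule exI[of _ "2 * M * A"],
      intro conjI allI impI)
    fix n :: nat and T :: real
    assume n: "n \<ge> 1" and T: "T > 0" and AT: "A * real n powr (real CARD('n) - 1 / real m) \<le> T"
    \<comment> \<open>For \<open>i \<le> m\<close> one has n^(-i/m) \<ge> 1/n, with equality at
      \<open>i = m\<close>; the factor \<open>A\<close> absorbs the constants of the derivative
      bounds.\<close>
    define \<tau> where "\<tau> = A * real n powr (- 1 / real m)"
    define N where "N = n ^ CARD('n)"
    define x :: "nat \<Rightarrow> real ^ 'n" where "x = grid_point e n"
    have \<tau>0: "\<tau> > 0" using A n by (simp add: \<tau>_def)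
    have N\<tau>: "real N * \<tau> = A * real n powr (real CARD('n) - 1 / real m)"
    proof -
      have "real N = real n powr real CARD('n)"
        using n by (simp add: N_def powr_realpow)
      then show ?thesis by (simp add: \<tau>_def powr_add[symmetric] mult.left_commute)
    qed
    obtain w where w: "\<And>j. 0 \<le> w j" "(\<Sum>j<N. w j) = 1"
      "\<And>f L. L-lipschitz_on UNIV f \<Longrightarrow> \<bar>(\<Sum>j<N. w j * f (torus_proj (x j))) - (\<integral>x. f x \<partial>\<pi>)\<bar> \<le> L * (d * (1 / real n))"
    proof -
      have "\<exists>j<N. dist z (torus_proj (x j)) \<le> d * (1 / real n)" for z
        using grid_point_net[OF e, of n z] n by (simp add: N_def x_def d_def)
      from ex_quadrature_weights[OF \<pi> this] show thesis
        using that by blast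
    qed
    have "\<exists>\<nu>\<in>curve_measures m \<alpha> T. \<forall>f L M. L-lipschitz_on UNIV f \<longrightarrow> (\<forall>y. \<bar>f y\<bar> \<le> M) \<longrightarrow>
      \<bar>(\<integral>y. f y \<partial>\<nu>) - (\<Sum>j<N. w j * f (torus_proj (x j)))\<bar>
        \<le> L * (K * (d * (1 / real n))) + 2 * M * (real N * \<tau> / T)"
    proof (rule ex_curve_near_quadrature[OF \<psi> K(2) _ w(1,2) \<tau>0 _ T])
      show "norm (x (Suc j) - x j) \<le> d * (1 / real n)" for j
        using grid_point_step[of n e j] n by (simp add: x_def d_def)
      show "real N * \<tau> \<le> T" using AT N\<tau> by simp
      fix i assume i: "i \<in> {1..m}"
      have "A * (1 / real n) \<le> \<tau> ^ i"
      proof -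
        have "A \<le> A ^ i" using A i by (intro self_le_power) auto
        moreover have "1 / real n \<le> (real n powr (- 1 / real m)) ^ i"
        proof -
          have "1 / real n = real n powr (- 1)"
            using n by (simp add: powr_minus_divide)
          also have "\<dots> \<le> real n powr (- (real i / real m))"
            using n m i by (intro powr_mono) (auto simp: divide_le_eq)
          also have "\<dots> = (real n powr (- 1 / real m)) ^ i"
            using n by (simp add: powr_power)
          finally show ?thesis .
        qed
        ultimately show ?thesis
          unfolding \<tau>_def power_mult_distrib using A n by (intro mult_mono) auto
      qed
      then have "A * (1 / real n) * \<alpha> i \<le> \<tau> ^ i * \<alpha> i"
        using \<alpha>[OF i] by (intro mult_right_mono) auto
      moreover have "K * d * (1 / real n) \<le> A * \<alpha> i * (1 / real n)"
        by (intro mult_right_mono A\<alpha>[OF i]) simp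
      ultimately show "K * (d * (1 / real n)) \<le> \<tau> ^ i * \<alpha> i"
        by (simp add: mult_ac)
    qed
    then obtain \<nu> where \<nu>: "\<nu> \<in> curve_measures m \<alpha> T"
      "\<And>f L M. L-lipschitz_on UNIV f \<Longrightarrow> (\<forall>y. \<bar>f y\<bar> \<le> M) \<Longrightarrow>
        \<bar>(\<integral>y. f y \<partial>\<nu>) - (\<Sum>j<N. w j * f (torus_proj (x j)))\<bar>
          \<le> L * (K * (d * (1 / real n))) + 2 * M * (real N * \<tau> / T)"
      by blast
    have "N_diff h \<nu> \<pi> \<le> L * (K + 1) * d / real n + 2 * M * A * (real n powr (real CARD('n) - 1 / real m) / T)"
    proof (rule N_diff_le[OF h prob_space_curve_measures[OF \<nu>(1) T] \<pi>])
      fix z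
      \<comment> \<open>The convolution at \<open>z\<close> is the integral of this reflected
        translate, whose constants \<open>L\<close> and \<open>M\<close> do not depend on
        \<open>z\<close>.\<close>
      have lip: "L-lipschitz_on UNIV (\<lambda>y. h (z - y))"
      proof (rule lipschitz_onI[OF _ L])
        fix y y' :: "'n torus"
        show "dist (h (z - y)) (h (z - y')) \<le> L * dist y y'"
          using lipschitz_onD[OF h, of "z - y" "z - y'"] mult_left_mono[OF dist_torus_diff_left[of z y y'] L]
          by simp
      qed
      have "\<bar>conv_measure h \<nu> z - conv_measure h \<pi> z\<bar>
          \<le> L * (K * (d * (1 / real n))) + 2 * M * (real N * \<tau> / T) + L * (d * (1 / real n))"
        using \<nu>(2)[OF lip, of M] w(3)[OF lip] M unfolding conv_measure_def by simp
      also have "\<dots> = L * (K + 1) * d / real n + 2 * M * A * (real n powr (real CARD('n) - 1 / real m) / T)"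
        unfolding N\<tau> by (simp add: algebra_simps add_divide_distrib)
      finally show "\<bar>conv_measure h \<nu> z - conv_measure h \<pi> z\<bar>
          \<le> L * (K + 1) * d / real n + 2 * M * A * (real n powr (real CARD('n) - 1 / real m) / T)" .
    qed
    then show "\<exists>\<nu>\<in>curve_measures m \<alpha> T. N_diff h \<nu> \<pi>
        \<le> L * (K + 1) * d / real n + 2 * M * A * (real n powr (real CARD('n) - 1 / real m) / T)"
      using \<nu>(1) by blast
  qed (use A L K(1) d0 M0 in auto)
qed

text \<open>Rounding the optimal real size down to an integer loses at most a factor 2, which only
  enters the constant of the rate.\<close>

lemma nat_floor_ge_half:
  fixes x :: real
  assumes "x \<ge> 1"
  shows "x / 2 \<le> real (nat \<lfloor>x\<rfloor>)" "real (nat \<lfloor>x\<rfloor>) \<le> x" "nat \<lfloor>x\<rfloor> \<ge> 1"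
proof -
  have "1 \<le> \<lfloor>x\<rfloor>" using assms by simp
  then show "nat \<lfloor>x\<rfloor> \<ge> 1" by linarith
  have "real (nat \<lfloor>x\<rfloor>) = of_int \<lfloor>x\<rfloor>" using \<open>1 \<le> \<lfloor>x\<rfloor>\<close> by simp
  then show "x / 2 \<le> real (nat \<lfloor>x\<rfloor>)" "real (nat \<lfloor>x\<rfloor>) \<le> x"
    using \<open>1 \<le> \<lfloor>x\<rfloor>\<close> by linarith+
qed

theorem theorem6:
  fixes \<pi> :: "('n::finite) torus measure" and h :: "'n torus \<Rightarrow> real"
    and m :: nat and \<alpha> :: "nat \<Rightarrow> real" and \<mu> :: "real \<Rightarrow> 'n torus measure"
  assumes "prob_space \<pi>" and "sets \<pi> = sets borel"
    and "m \<ge> 1" and "\<And>i. i \<in> {1..m} \<Longrightarrow> \<alpha> i > 0"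
    and "\<exists>L. L-lipschitz_on UNIV h"
    and "\<And>\<xi> :: int ^ 'n. torus_fourier h \<xi> \<noteq> 0"
    and "\<And>T. T > 0 \<Longrightarrow> is_arg_min (\<lambda>\<nu>. N_diff h \<nu> \<pi>) (\<lambda>\<nu>. \<nu> \<in> curve_measures m \<alpha> T) (\<mu> T)"
  shows "weakly_converges \<mu> \<pi> at_top \<and>
    (\<lambda>T. N_diff h (\<mu> T) \<pi>) \<in>
      O[at_top](\<lambda>T. T powr (- (real m / (real m * (real CARD('n) + 1) - 1))))"
proof -
  obtain L where L: "L-lipschitz_on UNIV h" using assms(5) by blast
  obtain A C1 C2 where A: "A \<ge> 0" "C1 \<ge> 0" "C2 \<ge> 0" and
    approx: "\<forall>n T. n \<ge> 1 \<longrightarrow> T > 0 \<longrightarrow> A * real n powr (real CARD('n) - 1 / real m) \<le> T \<longrightarrow>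
      (\<exists>\<nu>\<in>curve_measures m \<alpha> T.
        N_diff h \<nu> \<pi> \<le> C1 / real n + C2 * (real n powr (real CARD('n) - 1 / real m) / T))"
    using ex_curve_measure_N_diff_le[where \<alpha> = \<alpha>, OF assms(1-4) L] by blast
  define d where "d = real CARD('n)"
  \<comment> \<open>With n of size T^\<beta>, the balance n^(d+1-1/m) = T amounts to \<beta>
    (d+1-1/m) = 1; \<open>exponent\<close> below is this equation rearranged.\<close>
  define \<beta> where "\<beta> = real m / (real m * (d + 1) - 1)"
  have d: "d \<ge> 1" by (simp add: d_def Suc_leI)
  have m: "real m \<ge> 1" using assms(3) by simp
  have den: "real m * (d + 1) - 1 \<ge> 1"
    using mult_mono[of 1 "real m" 2 "d + 1"] m d by simp
  then have \<beta>: "\<beta> > 0" using m by (simp add: \<beta>_def)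
  have exponent: "\<beta> * (d - 1 / real m) = 1 - \<beta>"
  proof -
    have "real m * (d - 1 / real m) = real m * (d + 1) - 1 - real m"
      using m by (simp add: algebra_simps)
    then have "\<beta> * (d - 1 / real m) = (real m * (d + 1) - 1 - real m) / (real m * (d + 1) - 1)"
      by (simp add: \<beta>_def)
    then show ?thesis using den by (simp add: diff_divide_distrib[of _ "real m"] \<beta>_def)
  qed
  have dm: "d - 1 / real m \<ge> 0" using d m by (simp add: order_trans[of _ 1])
  have lim\<beta>: "((\<lambda>T. T powr (- \<beta>)) \<longlongrightarrow> 0) at_top"
    using \<beta> by (intro tendsto_neg_powr filterlim_ident) simp
  \<comment> \<open>The travel time is at most A T^(1-\<beta>), so this is what makes it fit into
    \<open>T\<close>.\<close>
  then have "\<forall>\<^sub>F T in at_top. A * T powr (- \<beta>) < 1"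
    using tendsto_mult_right_zero[of _ _ A] order_tendstoD(2)[of _ 0 at_top 1] by force
  then have bound: "\<forall>\<^sub>F T in at_top. N_diff h (\<mu> T) \<pi> \<le> (2 * C1 + C2) * T powr (- \<beta>)"
    using eventually_ge_at_top[of 1]
  proof eventually_elim
    case (elim T)
    define n where "n = nat \<lfloor>T powr \<beta>\<rfloor>"
    have "T powr \<beta> \<ge> 1" using elim(2) \<beta> by (simp add: ge_one_powr_ge_zero)
    note n = nat_floor_ge_half[OF this, folded n_def]
    have "real n powr (d - 1 / real m) \<le> (T powr \<beta>) powr (d - 1 / real m)"
      using n dm by (intro powr_mono2) auto
    also have "\<dots> = T powr (1 - \<beta>)" by (simp only: powr_powr exponent)
    also have "\<dots> = T * T powr (- \<beta>)"
      using elim(2) by (simp add: powr_diff powr_minus_divide)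
    finally have travel: "real n powr (d - 1 / real m) \<le> T * T powr (- \<beta>)" .
    have "A * real n powr (d - 1 / real m) \<le> T * (A * T powr (- \<beta>))"
      using mult_left_mono[OF travel A(1)] by (simp add: mult_ac)
    also have "\<dots> \<le> T * 1" using elim by (intro mult_left_mono) auto
    finally obtain \<nu> where \<nu>: "\<nu> \<in> curve_measures m \<alpha> T"
      "N_diff h \<nu> \<pi> \<le> C1 / real n + C2 * (real n powr (d - 1 / real m) / T)"
      using approx[rule_format, of n T] n(3) elim(2) unfolding d_def by auto
    have "N_diff h (\<mu> T) \<pi> \<le> N_diff h \<nu> \<pi>"
      using assms(7)[of T] elim(2) \<nu>(1) by (auto simp: is_arg_min_def not_less)
    also have "\<dots> \<le> C1 / real n + C2 * (real n powr (d - 1 / real m) / T)" by (rule \<nu>(2))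
    also have "\<dots> \<le> C1 * (2 * T powr (- \<beta>)) + C2 * T powr (- \<beta>)"
    proof (rule add_mono)
      have "1 / real n \<le> 1 / (T powr \<beta> / 2)"
        using n elim(2) by (intro divide_left_mono mult_pos_pos) auto
      then have "1 / real n \<le> 2 * T powr (- \<beta>)"
        by (simp add: powr_minus_divide)
      from mult_left_mono[OF this A(2)] show "C1 / real n \<le> C1 * (2 * T powr (- \<beta>))" by simp
      have "real n powr (d - 1 / real m) / T \<le> T powr (- \<beta>)"
        using travel elim(2) by (simp add: pos_divide_le_eq mult.commute)
      then show "C2 * (real n powr (d - 1 / real m) / T) \<le> C2 * T powr (- \<beta>)"
        by (rule mult_left_mono[OF _ A(3)])
    qed
    finally show ?case by (simp add: algebra_simps)
  qed
  have N_diff_nonneg: "0 \<le> N_diff h (\<mu> T) \<pi>" for T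
    by (simp add: N_diff_def)
  have "((\<lambda>T. N_diff h (\<mu> T) \<pi>) \<longlongrightarrow> 0) at_top"
    using bound N_diff_nonneg
    by (intro Lim_null_comparison[OF _ tendsto_mult_right_zero[OF lim\<beta>, of "2 * C1 + C2"]]) simp
  moreover have "\<forall>\<^sub>F T in at_top. prob_space (\<mu> T) \<and> sets (\<mu> T) = sets borel"
    using eventually_gt_at_top[of 0]
  proof eventually_elim
    case (elim T)
    then have "\<mu> T \<in> curve_measures m \<alpha> T" using assms(7) by (simp add: is_arg_min_def)
    then show ?case using prob_space_curve_measures elim by blast
  qed
  ultimately have "weakly_converges \<mu> \<pi> at_top"
    using N_diff_tendsto_imp_weakly_converges[OF L assms(6) _ assms(1,2)] by blast
  moreover have "(\<lambda>T. N_diff h (\<mu> T) \<pi>) \<in> O[at_top](\<lambda>T. T powr (- \<beta>))"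
    using bound by (intro bigoI[of _ "2 * C1 + C2"]) (simp add: N_diff_nonneg)
  ultimately show ?thesis by (simp add: \<beta>_def d_def)
qed

end
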